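(* Let $\mathcal{C}$ be a category with pullbacks of split epimorphisms along split epimorphisms and with equalizers. Then the following conditions are equivalent: (1) The category $\mathcal{C}$ is weakly Mal'tsev. (2) Every reflexive strong relation in $\mathcal{C}$ is an equivalence relation. (3) Every reflexive strong relation in $\mathcal{C}$ is a preorder. (4) Every strong relation in $\mathcal{C}$ is compatible with the class of all strong relations (i.e. is compatible with every strong relation). (5) Every dikite diagram in $\mathcal{C}$ whose direction is a strong relation is admissible. (6) Every strong relation in $\mathcal{C}$ is difunctional.
   Context: A span $(D,d,c)$ is a pair of morphisms $d\colon D\to D_0$, $c\colon D\to D_1$ both admitting kernel pairs, $(d_1,d_2\colon D(d)\to D)$ and $(c_1,c_2\colon D(c)\to D)$. A strong relation is a span (legs admitting kernel pairs) which is jointly strongly monic: $(d,c)$ is jointly monic and orthogonal to every jointly epic cospan, i.e. for every jointly epic cospan $e_1\colon A\to E$, $e_2\colon C\to E$ and all $\alpha\colon A\to D$, $\gamma\colon C\to D$, $u\colon E\to D_0$, $v\colon E\to D_1$ with $ue_1=d\alpha$, $ue_2=d\gamma$, $ve_1=c\alpha$, $ve_2=c\gamma$, there is a unique $m\colon E\to D$ with $me_1=\alpha$, $me_2=\gamma$, $dm=u$, $cm=v$. Local product: a diagram $p_1\colon E\to A$, $e_1\colon A\to E$, $p_2\colon E\to C$, $e_2\colon C\to E$ for which there are $f\colon A\to B$, $r\colon B\to A$, $g\colon C\to B$, $s\colon B\to C$ with $fr=1_B=gs$ such that $(E,p_1,p_2)$ is the pullback of $f$ and $g$, $e_1=\langle1_A,sf\rangle$,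 $e_2=\langle rg,1_C\rangle$. $\mathcal{C}$ is weakly Mal'tsev if it has pullbacks of split epimorphisms along split epimorphisms and in every local product the cospan $(e_1,e_2)$ is jointly epic. A reflexive strong relation is a reflexive graph $(C_1,C_0,d,e,c)$ ($de=1_{C_0}=ce$) whose span $(C_1,d,c)$ is a strong relation. It is a preorder (transitive) if it underlies an internal category, and an equivalence relation if it underlies an internal groupoid (reflexive, symmetric, transitive). Compatibility: a span $(E,p_1,p_2)$, $p_1\colon E\to A$, $p_2\colon E\to C$, is compatible with a span $(D,d,c)$ if for all $\alpha\colon A\to D$, $\gamma\colon C\to D$, $e_1\colon A\to E$, $e_2\colon C\to E$ with $p_1e_1=1_A$, $p_2e_2=1_C$, $(e_1p_1)(e_2p_2)=(e_2p_2)(e_1p_1)$, $\alpha p_1(e_2p_2)=\gamma p_2(e_1p_1)$, $d\alpha p_1=d\alpha p_1(e_2p_2)$, $c\gamma p_2=c\gamma p_2(e_1p_1)$, there is a unique $m\colon E\to D$ with $me_1=\alpha$, $me_2=\gamma$, $dm=d\gamma p_2$, $cm=c\alpha p_1$. Dikite diagram with direction $(D,d,c)$ (a span): morphisms $f\colon A\to B$, $r\colon B\to A$, $g\colon C\to B$, $s\colon B\to C$, $\alpha\colon A\to D$, $\beta\colon B\to D$, $\gamma\colon C\to D$ with $fr=1_B=gs$, $\alpha r=\beta=\gamma s$, $d\alpha=d\beta f$, $c\beta g=c\gamma$. It is admissible if there is a unique $m\colon A\times_BC\to D$ (pullback of $f$ and $g$, projections $\pi_1,\pi_2$) with $m\langle1_A,sf\rangle=\alpha$,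 $m\langle rg,1_C\rangle=\gamma$, $dm=d\gamma\pi_2$, $cm=c\alpha\pi_1$. Difunctional: let $D(d,c)$ be the pullback of $d_2\colon D(d)\to D$ and $c_1\colon D(c)\to D$, which classifies triples $\langle x,y,z\rangle$ of morphisms into $D$ with $dx=dy$, $cy=cz$. A jointly monic span $(D,d,c)$ is difunctional if there is $p\colon D(d,c)\to D$ with $dp\langle x,y,z\rangle=dz$ and $cp\langle x,y,z\rangle=cx$ for all such triples. *)

theory Defs
  imports Main
begin

record ('o, 'm) precategory =
  Obj :: "'o set"
  Arr :: "'m set"
  Dom :: "'m \<Rightarrow> 'o"
  Cod :: "'m \<Rightarrow> 'o"
  Ident :: "'o \<Rightarrow> 'm" ("\<one>\<index>")
  Comp :: "'m \<Rightarrow> 'm \<Rightarrow> 'm" (infixl "\<cdot>\<index>" 70)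

definition Hom :: "('o, 'm, 'x) precategory_scheme \<Rightarrow> 'o \<Rightarrow> 'o \<Rightarrow> 'm set"
  where "Hom \<C> A B = {f \<in> Arr \<C>. Dom \<C> f = A \<and> Cod \<C> f = B}"

text \<open>Composition is written in applicative order: \<open>g \<cdot> f\<close> is \<open>f\<close> followed by \<open>g\<close>.
  Its values on non-composable pairs are irrelevant.\<close>

locale category =
  fixes \<C> :: "('o, 'm) precategory" (structure)
  assumes Dom_Obj: "f \<in> Arr \<C> \<Longrightarrow> Dom \<C> f \<in> Obj \<C>"
    and Cod_Obj: "f \<in> Arr \<C> \<Longrightarrow> Cod \<C> f \<in> Obj \<C>"
    and Ident_Hom: "A \<in> Obj \<C> \<Longrightarrow> \<one> A \<in> Hom \<C> A A"
    and Comp_Hom: "f \<in> Hom \<C> A B \<Longrightarrow> g \<in> Hom \<C> B C \<Longrightarrow> g \<cdot> f \<in> Hom \<C> A C"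
    and Ident_left: "f \<in> Hom \<C> A B \<Longrightarrow> \<one> B \<cdot> f = f"
    and Ident_right: "f \<in> Hom \<C> A B \<Longrightarrow> f \<cdot> \<one> A = f"
    and Comp_assoc: "f \<in> Hom \<C> A B \<Longrightarrow> g \<in> Hom \<C> B C \<Longrightarrow> h \<in> Hom \<C> C D
      \<Longrightarrow> (h \<cdot> g) \<cdot> f = h \<cdot> (g \<cdot> f)"

context
  fixes \<C> :: "('o, 'm) precategory" (structure)
begin

definition pullback :: "'m \<Rightarrow> 'm \<Rightarrow> 'o \<Rightarrow> 'm \<Rightarrow> 'm \<Rightarrow> bool"
  where "pullback f g P p1 p2 \<longleftrightarrow>
    f \<in> Arr \<C> \<and> g \<in> Arr \<C> \<and> Cod \<C> f = Cod \<C> g \<and>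
    p1 \<in> Hom \<C> P (Dom \<C> f) \<and> p2 \<in> Hom \<C> P (Dom \<C> g) \<and> f \<cdot> p1 = g \<cdot> p2 \<and>
    (\<forall>X. \<forall>x\<in>Hom \<C> X (Dom \<C> f). \<forall>y\<in>Hom \<C> X (Dom \<C> g). f \<cdot> x = g \<cdot> y \<longrightarrow>
      (\<exists>!t. t \<in> Hom \<C> X P \<and> p1 \<cdot> t = x \<and> p2 \<cdot> t = y))"

text \<open>The morphism \<open>\<langle>x, y\<rangle>\<close> into a pullback with projections \<open>p1\<close>, \<open>p2\<close>; it is only used
  where \<open>(x, y)\<close> is a cone over the pulled back cospan.\<close>

definition pair :: "'m \<Rightarrow> 'm \<Rightarrow> 'm \<Rightarrow> 'm \<Rightarrow> 'm"
  where "pair p1 p2 x y =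
    (THE t. t \<in> Hom \<C> (Dom \<C> x) (Dom \<C> p1) \<and> p1 \<cdot> t = x \<and> p2 \<cdot> t = y)"

definition split_epi :: "'m \<Rightarrow> bool"
  where "split_epi f \<longleftrightarrow>
    f \<in> Arr \<C> \<and> (\<exists>r\<in>Hom \<C> (Cod \<C> f) (Dom \<C> f). f \<cdot> r = \<one> (Cod \<C> f))"

definition has_pullbacks_of_split_epis :: bool
  where "has_pullbacks_of_split_epis \<longleftrightarrow>
    (\<forall>f g. split_epi f \<and> split_epi g \<and> Cod \<C> f = Cod \<C> g \<longrightarrow>
      (\<exists>P p1 p2. pullback f g P p1 p2))"

definition equalizer :: "'m \<Rightarrow> 'm \<Rightarrow> 'o \<Rightarrow> 'm \<Rightarrow> bool"
  where "equalizer u v S k \<longleftrightarrow>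
    u \<in> Arr \<C> \<and> v \<in> Arr \<C> \<and> Dom \<C> u = Dom \<C> v \<and> Cod \<C> u = Cod \<C> v \<and>
    k \<in> Hom \<C> S (Dom \<C> u) \<and> u \<cdot> k = v \<cdot> k \<and>
    (\<forall>X. \<forall>h\<in>Hom \<C> X (Dom \<C> u). u \<cdot> h = v \<cdot> h \<longrightarrow> (\<exists>!t. t \<in> Hom \<C> X S \<and> k \<cdot> t = h))"

definition has_equalizers :: bool
  where "has_equalizers \<longleftrightarrow> (\<forall>A B. \<forall>u\<in>Hom \<C> A B. \<forall>v\<in>Hom \<C> A B. \<exists>S k. equalizer u v S k)"

definition jointly_epic :: "'m \<Rightarrow> 'm \<Rightarrow> bool"
  where "jointly_epic e1 e2 \<longleftrightarrow>
    e1 \<in> Arr \<C> \<and> e2 \<in> Arr \<C> \<and> Cod \<C> e1 = Cod \<C> e2 \<and>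
    (\<forall>Z. \<forall>h\<in>Hom \<C> (Cod \<C> e1) Z. \<forall>k\<in>Hom \<C> (Cod \<C> e1) Z.
      h \<cdot> e1 = k \<cdot> e1 \<and> h \<cdot> e2 = k \<cdot> e2 \<longrightarrow> h = k)"

definition jointly_monic :: "'m \<Rightarrow> 'm \<Rightarrow> bool"
  where "jointly_monic d c \<longleftrightarrow>
    d \<in> Arr \<C> \<and> c \<in> Arr \<C> \<and> Dom \<C> d = Dom \<C> c \<and>
    (\<forall>X. \<forall>h\<in>Hom \<C> X (Dom \<C> d). \<forall>k\<in>Hom \<C> X (Dom \<C> d).
      d \<cdot> h = d \<cdot> k \<and> c \<cdot> h = c \<cdot> k \<longrightarrow> h = k)"

abbreviation kernel_pair :: "'m \<Rightarrow> 'o \<Rightarrow> 'm \<Rightarrow> 'm \<Rightarrow> bool"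
  where "kernel_pair f K k1 k2 \<equiv> pullback f f K k1 k2"

definition span :: "'o \<Rightarrow> 'm \<Rightarrow> 'm \<Rightarrow> bool"
  where "span D d c \<longleftrightarrow>
    d \<in> Arr \<C> \<and> Dom \<C> d = D \<and> c \<in> Arr \<C> \<and> Dom \<C> c = D \<and>
    (\<exists>K k1 k2. kernel_pair d K k1 k2) \<and> (\<exists>K k1 k2. kernel_pair c K k1 k2)"

definition jointly_strongly_monic :: "'m \<Rightarrow> 'm \<Rightarrow> bool"
  where "jointly_strongly_monic d c \<longleftrightarrow>
    jointly_monic d c \<and>
    (\<forall>A C E e1 e2 \<alpha> \<gamma> u v.
      e1 \<in> Hom \<C> A E \<and> e2 \<in> Hom \<C> C E \<and> jointly_epic e1 e2 \<and>
      \<alpha> \<in> Hom \<C> A (Dom \<C> d) \<and> \<gamma> \<in> Hom \<C> C (Dom \<C> d) \<and>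
      u \<in> Hom \<C> E (Cod \<C> d) \<and> v \<in> Hom \<C> E (Cod \<C> c) \<and>
      u \<cdot> e1 = d \<cdot> \<alpha> \<and> u \<cdot> e2 = d \<cdot> \<gamma> \<and> v \<cdot> e1 = c \<cdot> \<alpha> \<and> v \<cdot> e2 = c \<cdot> \<gamma> \<longrightarrow>
      (\<exists>!m. m \<in> Hom \<C> E (Dom \<C> d) \<and>
        m \<cdot> e1 = \<alpha> \<and> m \<cdot> e2 = \<gamma> \<and> d \<cdot> m = u \<and> c \<cdot> m = v))"

definition strong_relation :: "'o \<Rightarrow> 'm \<Rightarrow> 'm \<Rightarrow> bool"
  where "strong_relation D d c \<longleftrightarrow> span D d c \<and> jointly_strongly_monic d c"

definition local_product :: "'o \<Rightarrow> 'o \<Rightarrow> 'o \<Rightarrow> 'm \<Rightarrow> 'm \<Rightarrow> 'm \<Rightarrow> 'm \<Rightarrow> bool"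
  where "local_product E A C p1 e1 p2 e2 \<longleftrightarrow>
    (\<exists>B f r g s.
      f \<in> Hom \<C> A B \<and> r \<in> Hom \<C> B A \<and> g \<in> Hom \<C> C B \<and> s \<in> Hom \<C> B C \<and>
      f \<cdot> r = \<one> B \<and> g \<cdot> s = \<one> B \<and>
      pullback f g E p1 p2 \<and>
      e1 = pair p1 p2 (\<one> A) (s \<cdot> f) \<and> e2 = pair p1 p2 (r \<cdot> g) (\<one> C))"

definition weakly_Maltsev :: bool
  where "weakly_Maltsev \<longleftrightarrow>
    has_pullbacks_of_split_epis \<and>
    (\<forall>E A C p1 e1 p2 e2. local_product E A C p1 e1 p2 e2 \<longrightarrow> jointly_epic e1 e2)"

definition reflexive_graph :: "'o \<Rightarrow> 'o \<Rightarrow> 'm \<Rightarrow> 'm \<Rightarrow> 'm \<Rightarrow> bool"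
  where "reflexive_graph C1 C0 d e c \<longleftrightarrow>
    d \<in> Hom \<C> C1 C0 \<and> e \<in> Hom \<C> C0 C1 \<and> c \<in> Hom \<C> C1 C0 \<and>
    d \<cdot> e = \<one> C0 \<and> c \<cdot> e = \<one> C0"

text \<open>\<open>C2\<close> is the object of pairs \<open>\<langle>x, y\<rangle>\<close> with \<open>d \<cdot> x = c \<cdot> y\<close>, on which \<open>m\<close> acts as
  ``\<open>y\<close> followed by \<open>x\<close>''; \<open>C3\<close> is the object of composable triples, with \<open>q1\<close> and \<open>q2\<close>
  projecting to the first two and to the last two components.\<close>

definition internal_category ::
  "'o \<Rightarrow> 'o \<Rightarrow> 'm \<Rightarrow> 'm \<Rightarrow> 'm \<Rightarrow> 'o \<Rightarrow> 'm \<Rightarrow> 'm \<Rightarrow> 'm \<Rightarrow> bool"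
  where "internal_category C1 C0 d e c C2 p1 p2 m \<longleftrightarrow>
    reflexive_graph C1 C0 d e c \<and>
    pullback d c C2 p1 p2 \<and>
    m \<in> Hom \<C> C2 C1 \<and>
    d \<cdot> m = d \<cdot> p2 \<and> c \<cdot> m = c \<cdot> p1 \<and>
    m \<cdot> pair p1 p2 (\<one> C1) (e \<cdot> d) = \<one> C1 \<and>
    m \<cdot> pair p1 p2 (e \<cdot> c) (\<one> C1) = \<one> C1 \<and>
    (\<exists>C3 q1 q2. pullback p2 p1 C3 q1 q2 \<and>
      m \<cdot> pair p1 p2 (m \<cdot> q1) (p2 \<cdot> q2) = m \<cdot> pair p1 p2 (p1 \<cdot> q1) (m \<cdot> q2))"

definition internal_groupoid ::
  "'o \<Rightarrow> 'o \<Rightarrow> 'm \<Rightarrow> 'm \<Rightarrow> 'm \<Rightarrow> 'o \<Rightarrow> 'm \<Rightarrow> 'm \<Rightarrow> 'm \<Rightarrow> 'm \<Rightarrow> bool"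
  where "internal_groupoid C1 C0 d e c C2 p1 p2 m i \<longleftrightarrow>
    internal_category C1 C0 d e c C2 p1 p2 m \<and>
    i \<in> Hom \<C> C1 C1 \<and> d \<cdot> i = c \<and> c \<cdot> i = d \<and>
    m \<cdot> pair p1 p2 (\<one> C1) i = e \<cdot> c \<and>
    m \<cdot> pair p1 p2 i (\<one> C1) = e \<cdot> d"

definition reflexive_strong_relation :: "'o \<Rightarrow> 'o \<Rightarrow> 'm \<Rightarrow> 'm \<Rightarrow> 'm \<Rightarrow> bool"
  where "reflexive_strong_relation C1 C0 d e c \<longleftrightarrow>
    reflexive_graph C1 C0 d e c \<and> strong_relation C1 d c"

definition is_preorder :: "'o \<Rightarrow> 'o \<Rightarrow> 'm \<Rightarrow> 'm \<Rightarrow> 'm \<Rightarrow> bool"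
  where "is_preorder C1 C0 d e c \<longleftrightarrow>
    reflexive_strong_relation C1 C0 d e c \<and>
    (\<exists>C2 p1 p2 m. internal_category C1 C0 d e c C2 p1 p2 m)"

definition is_equivalence_relation :: "'o \<Rightarrow> 'o \<Rightarrow> 'm \<Rightarrow> 'm \<Rightarrow> 'm \<Rightarrow> bool"
  where "is_equivalence_relation C1 C0 d e c \<longleftrightarrow>
    reflexive_strong_relation C1 C0 d e c \<and>
    (\<exists>C2 p1 p2 m i. internal_groupoid C1 C0 d e c C2 p1 p2 m i)"

definition compatible :: "'o \<Rightarrow> 'm \<Rightarrow> 'm \<Rightarrow> 'o \<Rightarrow> 'm \<Rightarrow> 'm \<Rightarrow> bool"
  where "compatible E p1 p2 D d c \<longleftrightarrow>
    span E p1 p2 \<and> span D d c \<and>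
    (\<forall>\<alpha> \<gamma> e1 e2.
      \<alpha> \<in> Hom \<C> (Cod \<C> p1) D \<and> \<gamma> \<in> Hom \<C> (Cod \<C> p2) D \<and>
      e1 \<in> Hom \<C> (Cod \<C> p1) E \<and> e2 \<in> Hom \<C> (Cod \<C> p2) E \<and>
      p1 \<cdot> e1 = \<one> (Cod \<C> p1) \<and> p2 \<cdot> e2 = \<one> (Cod \<C> p2) \<and>
      (e1 \<cdot> p1) \<cdot> (e2 \<cdot> p2) = (e2 \<cdot> p2) \<cdot> (e1 \<cdot> p1) \<and>
      \<alpha> \<cdot> p1 \<cdot> (e2 \<cdot> p2) = \<gamma> \<cdot> p2 \<cdot> (e1 \<cdot> p1) \<and>
      d \<cdot> \<alpha> \<cdot> p1 = d \<cdot> \<alpha> \<cdot> p1 \<cdot> (e2 \<cdot> p2) \<and>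
      c \<cdot> \<gamma> \<cdot> p2 = c \<cdot> \<gamma> \<cdot> p2 \<cdot> (e1 \<cdot> p1) \<longrightarrow>
      (\<exists>!m. m \<in> Hom \<C> E D \<and>
        m \<cdot> e1 = \<alpha> \<and> m \<cdot> e2 = \<gamma> \<and> d \<cdot> m = d \<cdot> \<gamma> \<cdot> p2 \<and> c \<cdot> m = c \<cdot> \<alpha> \<cdot> p1))"

definition dikite ::
  "'o \<Rightarrow> 'm \<Rightarrow> 'm \<Rightarrow> 'o \<Rightarrow> 'o \<Rightarrow> 'o \<Rightarrow> 'm \<Rightarrow> 'm \<Rightarrow> 'm \<Rightarrow> 'm \<Rightarrow> 'm \<Rightarrow> 'm \<Rightarrow> 'm \<Rightarrow> bool"
  where "dikite D d c A B C f r g s \<alpha> \<beta> \<gamma> \<longleftrightarrow>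
    span D d c \<and>
    f \<in> Hom \<C> A B \<and> r \<in> Hom \<C> B A \<and> g \<in> Hom \<C> C B \<and> s \<in> Hom \<C> B C \<and>
    \<alpha> \<in> Hom \<C> A D \<and> \<beta> \<in> Hom \<C> B D \<and> \<gamma> \<in> Hom \<C> C D \<and>
    f \<cdot> r = \<one> B \<and> g \<cdot> s = \<one> B \<and> \<alpha> \<cdot> r = \<beta> \<and> \<gamma> \<cdot> s = \<beta> \<and>
    d \<cdot> \<alpha> = d \<cdot> \<beta> \<cdot> f \<and> c \<cdot> \<beta> \<cdot> g = c \<cdot> \<gamma>"

text \<open>Pullbacks being unique up to isomorphism, the choice of \<open>A \<times>\<^sub>B C\<close> does not matter here,
  nor does the choice of \<open>D(d)\<close>, \<open>D(c)\<close> and \<open>D(d, c)\<close> in the definition of \<open>difunctional\<close>;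
  existential quantification rules out vacuous satisfaction.\<close>

definition admissible ::
  "'o \<Rightarrow> 'm \<Rightarrow> 'm \<Rightarrow> 'o \<Rightarrow> 'o \<Rightarrow> 'o \<Rightarrow> 'm \<Rightarrow> 'm \<Rightarrow> 'm \<Rightarrow> 'm \<Rightarrow> 'm \<Rightarrow> 'm \<Rightarrow> 'm \<Rightarrow> bool"
  where "admissible D d c A B C f r g s \<alpha> \<beta> \<gamma> \<longleftrightarrow>
    dikite D d c A B C f r g s \<alpha> \<beta> \<gamma> \<and>
    (\<exists>P \<pi>1 \<pi>2. pullback f g P \<pi>1 \<pi>2 \<and>
      (\<exists>!m. m \<in> Hom \<C> P D \<and>
        m \<cdot> pair \<pi>1 \<pi>2 (\<one> A) (s \<cdot> f) = \<alpha> \<and>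
        m \<cdot> pair \<pi>1 \<pi>2 (r \<cdot> g) (\<one> C) = \<gamma> \<and>
        d \<cdot> m = d \<cdot> \<gamma> \<cdot> \<pi>2 \<and> c \<cdot> m = c \<cdot> \<alpha> \<cdot> \<pi>1))"

definition difunctional :: "'o \<Rightarrow> 'm \<Rightarrow> 'm \<Rightarrow> bool"
  where "difunctional D d c \<longleftrightarrow>
    span D d c \<and> jointly_monic d c \<and>
    (\<exists>Dd d1 d2 Dc c1 c2 Ddc q1 q2 p.
      kernel_pair d Dd d1 d2 \<and> kernel_pair c Dc c1 c2 \<and> pullback d2 c1 Ddc q1 q2 \<and>
      p \<in> Hom \<C> Ddc D \<and>
      (\<forall>X. \<forall>x\<in>Hom \<C> X D. \<forall>y\<in>Hom \<C> X D. \<forall>z\<in>Hom \<C> X D.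
        d \<cdot> x = d \<cdot> y \<and> c \<cdot> y = c \<cdot> z \<longrightarrow>
        (let xyz = pair q1 q2 (pair d1 d2 x y) (pair c1 c2 y z)
         in d \<cdot> (p \<cdot> xyz) = d \<cdot> z \<and> c \<cdot> (p \<cdot> xyz) = c \<cdot> x)))"

end

definition all_equivalent :: "bool list \<Rightarrow> bool"
  where "all_equivalent Ps \<longleftrightarrow> (\<forall>P\<in>set Ps. \<forall>Q\<in>set Ps. P \<longleftrightarrow> Q)"

end

theory Submission
  imports Defs
begin

text \<open>
  The six conditions are tied together in a cycle: weakly Mal'tsev, compatibility, admissibility,
  difunctionality, equivalence relations, preorders, and back to weakly Mal'tsev.

  The link between cospans and relations is the definition of a strong relation: it lifts along
  jointly epic cospans. If \<open>\<C>\<close> is weakly Mal'tsev, the commuting idempotents \<open>e1 \<cdot> p1\<close> and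
  \<open>e2 \<cdot> p2\<close> of a strong relation \<open>(E, p1, p2)\<close> have a product that splits, because equalizers
  exist; this displays \<open>E\<close> as a local product, so \<open>(e1, e2)\<close> is jointly epic and any other strong
  relation lifts along it. That is compatibility
  (\<open>sections_of_strong_relation_jointly_epic\<close>, \<open>weakly_Maltsev_imp_compatible\<close>).

  Two specializations follow. A pullback of split epimorphisms is a strong relation whose two
  injections satisfy the equations required for compatibility, so compatibility contains the
  admissibility of dikites; and the dikite formed by the projections of the two kernel pairs of
  \<open>(D, d, c)\<close> onto their common component has a difunctionality operation as its lift. From such
  an operation \<open>p\<close> on a reflexive relation, composition is \<open>p \<langle>x, 1, y\<rangle>\<close> and inversion is
  \<open>p \<langle>1, x, 1\<rangle>\<close>, with the identities taken at the appropriate objects; all laws are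
  automatic in a relation.

  To return from preorders to weakly Mal'tsev, let \<open>h\<close> and \<open>k\<close> agree on the injections of a local
  product \<open>E\<close> of \<open>A\<close> and \<open>C\<close>. Their equalizer \<open>S\<close> is a strong relation from \<open>A\<close> to \<open>C\<close> containing
  all \<open>(a, s f a)\<close> and \<open>(r g c, c)\<close>. If \<open>S\<close> is difunctional, then whenever \<open>f a = g c\<close> the elements
  \<open>(a, s f a)\<close>, \<open>(r f a, s f a)\<close> and \<open>(r g c, c)\<close> of \<open>S\<close> force \<open>(a, c)\<close> into \<open>S\<close>; thus \<open>S\<close> is all of
  \<open>E\<close> and \<open>h = k\<close>. Difunctionality of \<open>S\<close> comes from the transitivity of a reflexive relation
  on \<open>S\<close> itself, which relates \<open>(a, c)\<close> to \<open>(a', c')\<close> when \<open>(a, c')\<close> lies in \<open>S\<close>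
  (\<open>preorders_imp_difunctional_elements\<close>).
\<close>

section \<open>Arrows\<close>

context category
begin

lemma Hom_iff [simp]: "f \<in> Hom \<C> A B \<longleftrightarrow> f \<in> Arr \<C> \<and> Dom \<C> f = A \<and> Cod \<C> f = B"
  by (auto simp: Hom_def)

lemma Dom_Obj_simp [simp]: "f \<in> Arr \<C> \<Longrightarrow> Dom \<C> f \<in> Obj \<C>"
  and Cod_Obj_simp [simp]: "f \<in> Arr \<C> \<Longrightarrow> Cod \<C> f \<in> Obj \<C>"
  by (fact Dom_Obj, fact Cod_Obj)

lemma Comp_simps [simp]:
  assumes "f \<in> Arr \<C>" "g \<in> Arr \<C>" "Dom \<C> g = Cod \<C> f"
  shows "g \<cdot> f \<in> Arr \<C>" "Dom \<C> (g \<cdot> f) = Dom \<C> f" "Cod \<C> (g \<cdot> f) = Cod \<C> g"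
  using Comp_Hom[of f "Dom \<C> f" "Cod \<C> f" g "Cod \<C> g"] assms by auto

lemma Ident_simps [simp]:
  assumes "A \<in> Obj \<C>"
  shows "\<one> A \<in> Arr \<C>" "Dom \<C> (\<one> A) = A" "Cod \<C> (\<one> A) = A"
  using Ident_Hom[OF assms] by auto

lemma Ident_Comp [simp]:
  assumes "f \<in> Arr \<C>"
  shows "Cod \<C> f = B \<Longrightarrow> \<one> B \<cdot> f = f" "Dom \<C> f = A \<Longrightarrow> f \<cdot> \<one> A = f"
  using Ident_left[of f "Dom \<C> f" "Cod \<C> f"] Ident_right[of f "Dom \<C> f" "Cod \<C> f"] assms
  by auto

lemma Comp_assoc_simp [simp]:
  assumes "f \<in> Arr \<C>" "g \<in> Arr \<C>" "h \<in> Arr \<C>" "Dom \<C> g = Cod \<C> f" "Dom \<C> h = Cod \<C> g"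
  shows "(h \<cdot> g) \<cdot> f = h \<cdot> (g \<cdot> f)"
  using Comp_assoc[of f "Dom \<C> f" "Cod \<C> f" g "Cod \<C> g" h "Cod \<C> h"] assms by auto

text \<open>Composites are kept bracketed to the right; this turns an equation between composites
  into a rewrite rule that also applies inside a longer composite.\<close>

lemma precomp:
  assumes "a \<cdot> b = a' \<cdot> b'" "a \<in> Arr \<C>" "b \<in> Arr \<C>" "a' \<in> Arr \<C>" "b' \<in> Arr \<C>"
    "Dom \<C> a = Cod \<C> b" "Dom \<C> a' = Cod \<C> b'"
    "x \<in> Arr \<C>" "Dom \<C> b = Cod \<C> x" "Dom \<C> b' = Cod \<C> x"
  shows "a \<cdot> (b \<cdot> x) = a' \<cdot> (b' \<cdot> x)"
  using assms Comp_assoc_simp[of x b a] Comp_assoc_simp[of x b' a'] by metis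

lemma precomp1:
  assumes "a \<cdot> b = c" "a \<in> Arr \<C>" "b \<in> Arr \<C>"
    "Dom \<C> a = Cod \<C> b" "x \<in> Arr \<C>" "Dom \<C> b = Cod \<C> x"
  shows "a \<cdot> (b \<cdot> x) = c \<cdot> x"
  using assms Comp_assoc_simp[of x b a] by metis

lemma Hom_Obj:
  assumes "f \<in> Hom \<C> A B"
  shows "A \<in> Obj \<C>" "B \<in> Obj \<C>"
  using assms by auto

lemma split_epiI:
  assumes "f \<in> Hom \<C> A B" "r \<in> Hom \<C> B A" "f \<cdot> r = \<one> B"
  shows "split_epi \<C> f"
  using assms by (auto simp: split_epi_def)

lemma jointly_monicD:
  assumes "jointly_monic \<C> d c" "h \<in> Hom \<C> X (Dom \<C> d)" "k \<in> Hom \<C> X (Dom \<C> d)"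
    "d \<cdot> h = d \<cdot> k" "c \<cdot> h = c \<cdot> k"
  shows "h = k"
  using assms unfolding jointly_monic_def by blast

lemma jointly_monicI:
  assumes "d \<in> Hom \<C> D D0" "c \<in> Hom \<C> D D1"
    and "\<And>X h k. h \<in> Hom \<C> X D \<Longrightarrow> k \<in> Hom \<C> X D \<Longrightarrow> d \<cdot> h = d \<cdot> k \<Longrightarrow> c \<cdot> h = c \<cdot> k \<Longrightarrow> h = k"
  shows "jointly_monic \<C> d c"
proof -
  have dc: "d \<in> Arr \<C>" "c \<in> Arr \<C>" "Dom \<C> d = D" "Dom \<C> c = D" using assms(1,2) by auto
  show ?thesis
    unfolding jointly_monic_def dc(3,4) using dc(1,2) assms(3) by blast
qed

lemma jointly_epicD:
  assumes "jointly_epic \<C> e1 e2" "h \<in> Hom \<C> (Cod \<C> e1) Z" "k \<in> Hom \<C> (Cod \<C> e1) Z"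
    "h \<cdot> e1 = k \<cdot> e1" "h \<cdot> e2 = k \<cdot> e2"
  shows "h = k"
  using assms unfolding jointly_epic_def by blast

section \<open>Pullbacks\<close>

lemma pullbackD:
  assumes "pullback \<C> f g P p1 p2"
  shows "f \<in> Arr \<C>" "g \<in> Arr \<C>" "Cod \<C> f = Cod \<C> g"
    "p1 \<in> Arr \<C>" "Dom \<C> p1 = P" "Cod \<C> p1 = Dom \<C> f"
    "p2 \<in> Arr \<C>" "Dom \<C> p2 = P" "Cod \<C> p2 = Dom \<C> g" "f \<cdot> p1 = g \<cdot> p2"
  using assms by (auto simp: pullback_def)

lemma pullback_jointly_monic:
  assumes "pullback \<C> f g P p1 p2"
  shows "jointly_monic \<C> p1 p2"
proof -
  note [simp] = pullbackD[OF assms]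
  have "h = k" if "h \<in> Hom \<C> X P" "k \<in> Hom \<C> X P" "p1 \<cdot> h = p1 \<cdot> k" "p2 \<cdot> h = p2 \<cdot> k" for X h k
  proof -
    have "\<exists>!t. t \<in> Hom \<C> X P \<and> p1 \<cdot> t = p1 \<cdot> h \<and> p2 \<cdot> t = p2 \<cdot> h"
      using assms that precomp[of f p1 g p2 h] unfolding pullback_def by auto
    then show ?thesis using that by metis
  qed
  then show ?thesis unfolding jointly_monic_def by simp
qed

lemma pair:
  assumes pb: "pullback \<C> f g P p1 p2"
    and "x \<in> Hom \<C> X (Dom \<C> f)" "y \<in> Hom \<C> X (Dom \<C> g)" "f \<cdot> x = g \<cdot> y"
  shows "pair \<C> p1 p2 x y \<in> Hom \<C> X P"
    "p1 \<cdot> pair \<C> p1 p2 x y = x" "p2 \<cdot> pair \<C> p1 p2 x y = y"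
proof -
  have "\<exists>!t. t \<in> Hom \<C> X P \<and> p1 \<cdot> t = x \<and> p2 \<cdot> t = y"
    using assms unfolding pullback_def by blast
  moreover have "Dom \<C> x = X" "Dom \<C> p1 = P"
    using assms pullbackD(5)[OF pb] by auto
  ultimately have "pair \<C> p1 p2 x y \<in> Hom \<C> X P \<and>
      p1 \<cdot> pair \<C> p1 p2 x y = x \<and> p2 \<cdot> pair \<C> p1 p2 x y = y"
    unfolding pair_def by (simp only:) (rule theI')
  then show "pair \<C> p1 p2 x y \<in> Hom \<C> X P"
    "p1 \<cdot> pair \<C> p1 p2 x y = x" "p2 \<cdot> pair \<C> p1 p2 x y = y" by auto
qed

lemmas pair_simps = pair(1)[unfolded Hom_iff] pair(2,3)

lemma kernel_pair_projections_split_epi: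
  assumes kp: "kernel_pair \<C> f K k1 k2"
  shows "split_epi \<C> k1" "split_epi \<C> k2"
proof -
  note [simp] = pullbackD[OF kp]
  have x: "pair \<C> k1 k2 (\<one> (Dom \<C> f)) (\<one> (Dom \<C> f)) \<in> Hom \<C> (Dom \<C> f) K"
    "k1 \<cdot> pair \<C> k1 k2 (\<one> (Dom \<C> f)) (\<one> (Dom \<C> f)) = \<one> (Dom \<C> f)"
    "k2 \<cdot> pair \<C> k1 k2 (\<one> (Dom \<C> f)) (\<one> (Dom \<C> f)) = \<one> (Dom \<C> f)"
    using pair[OF kp, of "\<one> (Dom \<C> f)" "Dom \<C> f" "\<one> (Dom \<C> f)"] by simp_all
  show "split_epi \<C> k1" by (rule split_epiI[OF _ x(1,2)]) simp
  show "split_epi \<C> k2" by (rule split_epiI[OF _ x(1,3)]) simp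
qed

lemma local_product_injections:
  assumes pb: "pullback \<C> f g P p1 p2"
    and fr: "f \<in> Hom \<C> A B" "r \<in> Hom \<C> B A" "f \<cdot> r = \<one> B"
    and gs: "g \<in> Hom \<C> C B" "s \<in> Hom \<C> B C" "g \<cdot> s = \<one> B"
  shows "pair \<C> p1 p2 (\<one> A) (s \<cdot> f) \<in> Hom \<C> A P"
    "p1 \<cdot> pair \<C> p1 p2 (\<one> A) (s \<cdot> f) = \<one> A" "p2 \<cdot> pair \<C> p1 p2 (\<one> A) (s \<cdot> f) = s \<cdot> f"
    "pair \<C> p1 p2 (r \<cdot> g) (\<one> C) \<in> Hom \<C> C P"
    "p1 \<cdot> pair \<C> p1 p2 (r \<cdot> g) (\<one> C) = r \<cdot> g" "p2 \<cdot> pair \<C> p1 p2 (r \<cdot> g) (\<one> C) = \<one> C"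
proof -
  have o [simp]: "A \<in> Obj \<C>" "B \<in> Obj \<C>" "C \<in> Obj \<C>" using fr gs by auto
  have 1: "\<one> A \<in> Hom \<C> A (Dom \<C> f)" "s \<cdot> f \<in> Hom \<C> A (Dom \<C> g)" "f \<cdot> \<one> A = g \<cdot> (s \<cdot> f)"
    using fr gs precomp1[OF gs(3), of f] by auto
  have 2: "r \<cdot> g \<in> Hom \<C> C (Dom \<C> f)" "\<one> C \<in> Hom \<C> C (Dom \<C> g)" "f \<cdot> (r \<cdot> g) = g \<cdot> \<one> C"
    using fr gs precomp1[OF fr(3), of g] by auto
  show "pair \<C> p1 p2 (\<one> A) (s \<cdot> f) \<in> Hom \<C> A P"
    "p1 \<cdot> pair \<C> p1 p2 (\<one> A) (s \<cdot> f) = \<one> A" "p2 \<cdot> pair \<C> p1 p2 (\<one> A) (s \<cdot> f) = s \<cdot> f"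
    using pair[OF pb 1] by auto
  show "pair \<C> p1 p2 (r \<cdot> g) (\<one> C) \<in> Hom \<C> C P"
    "p1 \<cdot> pair \<C> p1 p2 (r \<cdot> g) (\<one> C) = r \<cdot> g" "p2 \<cdot> pair \<C> p1 p2 (r \<cdot> g) (\<one> C) = \<one> C"
    using pair[OF pb 2] by auto
qed

lemma pullback_projections_split_epi:
  assumes pb: "pullback \<C> f g P p1 p2" and "split_epi \<C> f" "split_epi \<C> g"
  shows "split_epi \<C> p1" "split_epi \<C> p2"
proof -
  note [simp] = pullbackD[OF pb]
  obtain r where r: "r \<in> Hom \<C> (Cod \<C> f) (Dom \<C> f)" "f \<cdot> r = \<one> (Cod \<C> f)"
    using assms(2) unfolding split_epi_def by blast
  obtain s where s: "s \<in> Hom \<C> (Cod \<C> f) (Dom \<C> g)" "g \<cdot> s = \<one> (Cod \<C> f)"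
    using assms(3) pullbackD(3)[OF pb] unfolding split_epi_def by metis
  have "f \<in> Hom \<C> (Dom \<C> f) (Cod \<C> f)" "g \<in> Hom \<C> (Dom \<C> g) (Cod \<C> f)" by auto
  note inj = local_product_injections[OF pb this(1) r this(2) s]
  show "split_epi \<C> p1" by (rule split_epiI[OF _ inj(1,2)]) simp
  show "split_epi \<C> p2" by (rule split_epiI[OF _ inj(4,6)]) simp
qed

section \<open>Strong relations\<close>

text \<open>Joint monicity forces both the uniqueness of the diagonal and its compatibility with
  \<open>\<alpha>\<close> and \<open>\<gamma>\<close>, so it only has to lift \<open>(u, v)\<close>.\<close>

lemma jointly_strongly_monicI:
  assumes mono: "jointly_monic \<C> d c"
    and lift: "\<And>A C E e1 e2 \<alpha> \<gamma> u v. e1 \<in> Hom \<C> A E \<Longrightarrow> e2 \<in> Hom \<C> C E \<Longrightarrow> jointly_epic \<C> e1 e2 \<Longrightarrow>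
      \<alpha> \<in> Hom \<C> A (Dom \<C> d) \<Longrightarrow> \<gamma> \<in> Hom \<C> C (Dom \<C> d) \<Longrightarrow>
      u \<in> Hom \<C> E (Cod \<C> d) \<Longrightarrow> v \<in> Hom \<C> E (Cod \<C> c) \<Longrightarrow>
      u \<cdot> e1 = d \<cdot> \<alpha> \<Longrightarrow> u \<cdot> e2 = d \<cdot> \<gamma> \<Longrightarrow> v \<cdot> e1 = c \<cdot> \<alpha> \<Longrightarrow> v \<cdot> e2 = c \<cdot> \<gamma> \<Longrightarrow>
      \<exists>m. m \<in> Hom \<C> E (Dom \<C> d) \<and> d \<cdot> m = u \<and> c \<cdot> m = v"
  shows "jointly_strongly_monic \<C> d c"
  unfolding jointly_strongly_monic_def
proof (intro conjI mono allI impI, elim conjE)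
  fix A C E e1 e2 \<alpha> \<gamma> u v
  assume e: "e1 \<in> Hom \<C> A E" "e2 \<in> Hom \<C> C E" "jointly_epic \<C> e1 e2"
    and \<alpha>: "\<alpha> \<in> Hom \<C> A (Dom \<C> d)" and \<gamma>: "\<gamma> \<in> Hom \<C> C (Dom \<C> d)"
    and uv: "u \<in> Hom \<C> E (Cod \<C> d)" "v \<in> Hom \<C> E (Cod \<C> c)"
    and eq: "u \<cdot> e1 = d \<cdot> \<alpha>" "u \<cdot> e2 = d \<cdot> \<gamma>" "v \<cdot> e1 = c \<cdot> \<alpha>" "v \<cdot> e2 = c \<cdot> \<gamma>"
  obtain m where m: "m \<in> Hom \<C> E (Dom \<C> d)" "d \<cdot> m = u" "c \<cdot> m = v"
    using lift[OF e \<alpha> \<gamma> uv eq] by blast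
  have dc: "d \<in> Arr \<C>" "c \<in> Arr \<C>" "Dom \<C> d = Dom \<C> c"
    using mono by (auto simp: jointly_monic_def)
  have "m \<cdot> e1 = \<alpha>"
    by (rule jointly_monicD[OF mono _ \<alpha>])
      (use e m dc eq \<alpha> \<gamma> in \<open>auto simp: precomp1[OF m(2)] precomp1[OF m(3)]\<close>)
  moreover have "m \<cdot> e2 = \<gamma>"
    by (rule jointly_monicD[OF mono _ \<gamma>])
      (use e m dc eq \<alpha> \<gamma> in \<open>auto simp: precomp1[OF m(2)] precomp1[OF m(3)]\<close>)
  ultimately have m': "m \<in> Hom \<C> E (Dom \<C> d) \<and> m \<cdot> e1 = \<alpha> \<and> m \<cdot> e2 = \<gamma> \<and> d \<cdot> m = u \<and> c \<cdot> m = v"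
    using m by blast
  show "\<exists>!m. m \<in> Hom \<C> E (Dom \<C> d) \<and> m \<cdot> e1 = \<alpha> \<and> m \<cdot> e2 = \<gamma> \<and> d \<cdot> m = u \<and> c \<cdot> m = v"
  proof (intro ex1I[of _ m])
    fix m'
    assume "m' \<in> Hom \<C> E (Dom \<C> d) \<and> m' \<cdot> e1 = \<alpha> \<and> m' \<cdot> e2 = \<gamma> \<and> d \<cdot> m' = u \<and> c \<cdot> m' = v"
    then show "m' = m"
      using m by (intro jointly_monicD[OF mono, of m' E m]) auto
  qed (fact m')
qed

lemma jointly_strongly_monicD:
  assumes "jointly_strongly_monic \<C> d c"
    and "jointly_epic \<C> e1 e2" "e1 \<in> Hom \<C> A E" "e2 \<in> Hom \<C> C E"
    and "\<alpha> \<in> Hom \<C> A (Dom \<C> d)" "\<gamma> \<in> Hom \<C> C (Dom \<C> d)"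
    and "u \<in> Hom \<C> E (Cod \<C> d)" "v \<in> Hom \<C> E (Cod \<C> c)"
    and "u \<cdot> e1 = d \<cdot> \<alpha>" "u \<cdot> e2 = d \<cdot> \<gamma>" "v \<cdot> e1 = c \<cdot> \<alpha>" "v \<cdot> e2 = c \<cdot> \<gamma>"
  shows "\<exists>!m. m \<in> Hom \<C> E (Dom \<C> d) \<and> m \<cdot> e1 = \<alpha> \<and> m \<cdot> e2 = \<gamma> \<and> d \<cdot> m = u \<and> c \<cdot> m = v"
  using assms unfolding jointly_strongly_monic_def by blast

text \<open>Two maps agreeing on a jointly epic cospan agree, so the pair \<open>(u, v)\<close> to be lifted is a cone
  over \<open>(f, g)\<close> and factors through the pullback.\<close>

lemma pullback_jointly_strongly_monic:
  assumes pb: "pullback \<C> f g P p1 p2"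
  shows "jointly_strongly_monic \<C> p1 p2"
proof (rule jointly_strongly_monicI[OF pullback_jointly_monic[OF pb]])
  note [simp] = pullbackD[OF pb]
  fix A C E e1 e2 \<alpha> \<gamma> u v
  assume e: "e1 \<in> Hom \<C> A E" "e2 \<in> Hom \<C> C E" "jointly_epic \<C> e1 e2"
    and \<alpha>: "\<alpha> \<in> Hom \<C> A (Dom \<C> p1)" and \<gamma>: "\<gamma> \<in> Hom \<C> C (Dom \<C> p1)"
    and uv: "u \<in> Hom \<C> E (Cod \<C> p1)" "v \<in> Hom \<C> E (Cod \<C> p2)"
    and eq: "u \<cdot> e1 = p1 \<cdot> \<alpha>" "u \<cdot> e2 = p1 \<cdot> \<gamma>" "v \<cdot> e1 = p2 \<cdot> \<alpha>" "v \<cdot> e2 = p2 \<cdot> \<gamma>"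
  have "f \<cdot> u = g \<cdot> v"
    by (rule jointly_epicD[OF e(3), of _ "Cod \<C> f"])
      (use e uv \<alpha> \<gamma> in \<open>auto simp: eq precomp[OF pullbackD(10)[OF pb]]\<close>)
  then show "\<exists>m. m \<in> Hom \<C> E (Dom \<C> p1) \<and> p1 \<cdot> m = u \<and> p2 \<cdot> m = v"
    using pair[OF pb, of u E v] uv by (intro exI[of _ "pair \<C> p1 p2 u v"]) auto
qed

lemma jointly_strongly_monic_imp_jointly_monic:
  "jointly_strongly_monic \<C> d c \<Longrightarrow> jointly_monic \<C> d c"
  by (simp add: jointly_strongly_monic_def)

lemma equalizer_factor:
  assumes "equalizer \<C> u v S k" "h \<in> Hom \<C> X (Dom \<C> u)" "u \<cdot> h = v \<cdot> h"
  shows "\<exists>!t. t \<in> Hom \<C> X S \<and> k \<cdot> t = h"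
  using assms unfolding equalizer_def by blast

lemma equalizerD:
  assumes "equalizer \<C> u v S k"
  shows "u \<in> Arr \<C>" "v \<in> Arr \<C>" "Dom \<C> u = Dom \<C> v" "Cod \<C> u = Cod \<C> v"
    "k \<in> Arr \<C>" "Dom \<C> k = S" "Cod \<C> k = Dom \<C> v" "u \<cdot> k = v \<cdot> k"
  using assms by (auto simp: equalizer_def)

lemma equalizer_monic:
  assumes eq: "equalizer \<C> u v S k"
    and "x \<in> Hom \<C> X S" "y \<in> Hom \<C> X S" "k \<cdot> x = k \<cdot> y"
  shows "x = y"
proof -
  note [simp] = equalizerD[OF eq]
  have "k \<cdot> y \<in> Hom \<C> X (Dom \<C> u)" "u \<cdot> (k \<cdot> y) = v \<cdot> (k \<cdot> y)"
    using assms(3) by (auto simp: precomp[OF equalizerD(8)[OF eq]])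
  from equalizer_factor[OF eq this] show ?thesis using assms(2-4) by metis
qed

text \<open>The lift \<open>m\<close> into the ambient relation satisfies \<open>h \<cdot> m = k \<cdot> m\<close>, since on the legs of the
  jointly epic cospan it factors through \<open>\<iota>\<close>; hence \<open>m\<close> itself factors through \<open>\<iota>\<close>.\<close>

lemma equalizer_jointly_strongly_monic:
  assumes jsm: "jointly_strongly_monic \<C> p1 p2" and eq: "equalizer \<C> h k S \<iota>"
    and h: "Dom \<C> h = Dom \<C> p1"
  shows "jointly_strongly_monic \<C> (p1 \<cdot> \<iota>) (p2 \<cdot> \<iota>)"
proof -
  note mono = jointly_strongly_monic_imp_jointly_monic[OF jsm]
  have p [simp]: "p1 \<in> Arr \<C>" "p2 \<in> Arr \<C>" "Dom \<C> p1 = Dom \<C> p2"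
    using mono by (auto simp: jointly_monic_def)
  note eqD = equalizerD[OF eq]
  have k: "Dom \<C> k = Dom \<C> p2" using eqD h by simp
  note [simp] = eqD(1,2,4,5,6) eqD(3)[unfolded k] eqD(7)[unfolded k] k
  show ?thesis
  proof (rule jointly_strongly_monicI)
    show "jointly_monic \<C> (p1 \<cdot> \<iota>) (p2 \<cdot> \<iota>)"
    proof (rule jointly_monicI)
      show "p1 \<cdot> \<iota> \<in> Hom \<C> S (Cod \<C> p1)" "p2 \<cdot> \<iota> \<in> Hom \<C> S (Cod \<C> p2)" by auto
    next
      fix X x y
      assume xy: "x \<in> Hom \<C> X S" "y \<in> Hom \<C> X S"
        "p1 \<cdot> \<iota> \<cdot> x = p1 \<cdot> \<iota> \<cdot> y" "p2 \<cdot> \<iota> \<cdot> x = p2 \<cdot> \<iota> \<cdot> y"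
      have "\<iota> \<cdot> x = \<iota> \<cdot> y"
        by (rule jointly_monicD[OF mono, of _ X]) (use xy in auto)
      then show "x = y"
        by (intro equalizer_monic[OF eq, of x X y]) (use xy in auto)
    qed
  next
    fix A C E e1 e2 \<alpha> \<gamma> u v
    assume e: "e1 \<in> Hom \<C> A E" "e2 \<in> Hom \<C> C E" "jointly_epic \<C> e1 e2"
      and \<alpha>: "\<alpha> \<in> Hom \<C> A (Dom \<C> (p1 \<cdot> \<iota>))" and \<gamma>: "\<gamma> \<in> Hom \<C> C (Dom \<C> (p1 \<cdot> \<iota>))"
      and uv: "u \<in> Hom \<C> E (Cod \<C> (p1 \<cdot> \<iota>))" "v \<in> Hom \<C> E (Cod \<C> (p2 \<cdot> \<iota>))"
      and eqs: "u \<cdot> e1 = p1 \<cdot> \<iota> \<cdot> \<alpha>" "u \<cdot> e2 = p1 \<cdot> \<iota> \<cdot> \<gamma>"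
        "v \<cdot> e1 = p2 \<cdot> \<iota> \<cdot> \<alpha>" "v \<cdot> e2 = p2 \<cdot> \<iota> \<cdot> \<gamma>"
    obtain m where m: "m \<in> Hom \<C> E (Dom \<C> p1)" "m \<cdot> e1 = \<iota> \<cdot> \<alpha>" "m \<cdot> e2 = \<iota> \<cdot> \<gamma>"
      "p1 \<cdot> m = u" "p2 \<cdot> m = v"
      using ex1_implies_ex[OF jointly_strongly_monicD[OF jsm e(3,1,2),
          of "\<iota> \<cdot> \<alpha>" "\<iota> \<cdot> \<gamma>" u v]] \<alpha> \<gamma> uv eqs by auto
    have "h \<cdot> m = k \<cdot> m"
      by (rule jointly_epicD[OF e(3), of _ "Cod \<C> h"])
        (use e m(1) \<alpha> \<gamma> in \<open>auto simp: m(2,3) precomp[OF eqD(8)]\<close>)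
    then obtain t where "t \<in> Hom \<C> E S" "\<iota> \<cdot> t = m"
      using ex1_implies_ex[OF equalizer_factor[OF eq, of m E]] m(1) by auto
    then show "\<exists>t. t \<in> Hom \<C> E (Dom \<C> (p1 \<cdot> \<iota>)) \<and> p1 \<cdot> \<iota> \<cdot> t = u \<and> p2 \<cdot> \<iota> \<cdot> t = v"
      using m by (intro exI[of _ t]) auto
  qed
qed

text \<open>The idempotent splits through its object of fixed points, the equalizer with the identity.\<close>

lemma idempotent_splits:
  assumes "has_equalizers \<C>" and \<epsilon>: "\<epsilon> \<in> Hom \<C> E E" "\<epsilon> \<cdot> \<epsilon> = \<epsilon>"
  shows "\<exists>B k q. k \<in> Hom \<C> B E \<and> q \<in> Hom \<C> E B \<and> k \<cdot> q = \<epsilon> \<and> q \<cdot> k = \<one> B"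
proof -
  have E [simp]: "E \<in> Obj \<C>" using \<epsilon> by auto
  obtain B k where eq: "equalizer \<C> \<epsilon> (\<one> E) B k"
    using assms(1) \<epsilon> Ident_Hom[OF E] unfolding has_equalizers_def by blast
  have k: "k \<in> Hom \<C> B E" "\<epsilon> \<cdot> k = k" using equalizerD[OF eq] by auto
  obtain q where q: "q \<in> Hom \<C> E B" "k \<cdot> q = \<epsilon>"
    using ex1_implies_ex[OF equalizer_factor[OF eq, of \<epsilon> E]] \<epsilon> by auto
  have "q \<cdot> k = \<one> B"
    by (rule equalizer_monic[OF eq, of _ B]) (use k q precomp1[OF q(2), of k] in auto)
  with k q show ?thesis by blast
qed

section \<open>Reflexive relations\<close>

lemma reflexive_graphD:
  assumes "reflexive_graph \<C> C1 C0 d e c"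
  shows "C1 \<in> Obj \<C>" "C0 \<in> Obj \<C>" "d \<in> Arr \<C>" "Dom \<C> d = C1" "Cod \<C> d = C0"
    "c \<in> Arr \<C>" "Dom \<C> c = C1" "Cod \<C> c = C0"
    "e \<in> Arr \<C>" "Dom \<C> e = C0" "Cod \<C> e = C1" "d \<cdot> e = \<one> C0" "c \<cdot> e = \<one> C0"
    "x \<in> Arr \<C> \<Longrightarrow> Cod \<C> x = C0 \<Longrightarrow> d \<cdot> (e \<cdot> x) = x"
    "x \<in> Arr \<C> \<Longrightarrow> Cod \<C> x = C0 \<Longrightarrow> c \<cdot> (e \<cdot> x) = x"
  using assms precomp1[of d e "\<one> C0" x] precomp1[of c e "\<one> C0" x]
  by (auto simp: reflexive_graph_def)

lemma reflexive_graph_split_epi: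
  assumes "reflexive_graph \<C> C1 C0 d e c"
  shows "split_epi \<C> d" "split_epi \<C> c"
  using assms split_epiI unfolding reflexive_graph_def by blast+

end

locale category_with_split_pullbacks = category +
  assumes pullbacks: "has_pullbacks_of_split_epis \<C>"
begin

lemma split_pullback:
  assumes "split_epi \<C> f" "split_epi \<C> g" "Cod \<C> f = Cod \<C> g"
  obtains P p1 p2 where "pullback \<C> f g P p1 p2"
  using assms pullbacks unfolding has_pullbacks_of_split_epis_def by blast

lemma split_span:
  assumes "split_epi \<C> d" "split_epi \<C> c" "Dom \<C> d = D" "Dom \<C> c = D"
  shows "span \<C> D d c"
  using assms split_pullback[of d d] split_pullback[of c c]
  unfolding span_def split_epi_def by metis

text \<open>Both sides of each law have the same source and the same target, and joint monicity of
  \<open>(d, c)\<close> makes parallel arrows of the relation equal.\<close>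

lemma internal_category_if_jointly_monic:
  assumes rg: "reflexive_graph \<C> C1 C0 d e c" and mono: "jointly_monic \<C> d c"
    and pb: "pullback \<C> d c C2 p1 p2"
    and m: "m \<in> Hom \<C> C2 C1" "d \<cdot> m = d \<cdot> p2" "c \<cdot> m = c \<cdot> p1"
  shows "internal_category \<C> C1 C0 d e c C2 p1 p2 m"
proof -
  note [simp] = reflexive_graphD[OF rg] pullbackD(4-9)[OF pb]
  have [simp]: "m \<in> Arr \<C>" "Dom \<C> m = C2" "Cod \<C> m = C1" using m by auto
  note [simp] = precomp[OF pullbackD(10)[OF pb]] precomp[OF m(2)] precomp[OF m(3)]
  obtain C3 q1 q2 where pb3: "pullback \<C> p2 p1 C3 q1 q2"
    using split_pullback[of p2 p1] pullback_projections_split_epi[OF pb reflexive_graph_split_epi[OF rg]]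
    by auto
  note [simp] = pullbackD(4-9)[OF pb3] pullbackD(10)[OF pb3]
  note U1 = pair_simps[OF pb, of "\<one> C1" C1 "e \<cdot> d"]
  have 1: "m \<cdot> pair \<C> p1 p2 (\<one> C1) (e \<cdot> d) = \<one> C1"
    by (rule jointly_monicD[OF mono, of _ C1]) (auto simp: U1)
  note U2 = pair_simps[OF pb, of "e \<cdot> c" C1 "\<one> C1"]
  have 2: "m \<cdot> pair \<C> p1 p2 (e \<cdot> c) (\<one> C1) = \<one> C1"
    by (rule jointly_monicD[OF mono, of _ C1]) (auto simp: U2)
  note T1 = pair_simps[OF pb, of "m \<cdot> q1" C3 "p2 \<cdot> q2"]
    and T2 = pair_simps[OF pb, of "p1 \<cdot> q1" C3 "m \<cdot> q2"]
  have "m \<cdot> pair \<C> p1 p2 (m \<cdot> q1) (p2 \<cdot> q2) = m \<cdot> pair \<C> p1 p2 (p1 \<cdot> q1) (m \<cdot> q2)"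
    by (rule jointly_monicD[OF mono, of _ C3]) (auto simp: T1 T2)
  with pb3 1 2 rg pb m show ?thesis unfolding internal_category_def by blast
qed

text \<open>The inverse laws hold for the same reason, once \<open>i\<close> exchanges source and target.\<close>

lemma internal_groupoid_if_jointly_monic:
  assumes rg: "reflexive_graph \<C> C1 C0 d e c" and mono: "jointly_monic \<C> d c"
    and pb: "pullback \<C> d c C2 p1 p2"
    and m: "m \<in> Hom \<C> C2 C1" "d \<cdot> m = d \<cdot> p2" "c \<cdot> m = c \<cdot> p1"
    and i: "i \<in> Hom \<C> C1 C1" "d \<cdot> i = c" "c \<cdot> i = d"
  shows "internal_groupoid \<C> C1 C0 d e c C2 p1 p2 m i"
proof -
  note [simp] = reflexive_graphD[OF rg] pullbackD(4-9)[OF pb]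
  have [simp]: "m \<in> Arr \<C>" "Dom \<C> m = C2" "Cod \<C> m = C1" using m by auto
  note [simp] = precomp[OF m(2)] precomp[OF m(3)]
  note U1 = pair_simps[OF pb, of "\<one> C1" C1 i] and U2 = pair_simps[OF pb, of i C1 "\<one> C1"]
  have 1: "m \<cdot> pair \<C> p1 p2 (\<one> C1) i = e \<cdot> c"
    by (rule jointly_monicD[OF mono, of _ C1]) (use i in \<open>auto simp: U1\<close>)
  have 2: "m \<cdot> pair \<C> p1 p2 i (\<one> C1) = e \<cdot> d"
    by (rule jointly_monicD[OF mono, of _ C1]) (use i in \<open>auto simp: U2\<close>)
  show ?thesis
    using internal_category_if_jointly_monic[OF rg mono pb m] i 1 2
    unfolding internal_groupoid_def by blast
qed


section \<open>Triples and difunctionality\<close>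

text \<open>\<open>T\<close> classifies triples of elements of \<open>D\<close>; its middle component is \<open>d2 \<cdot> q1 = c1 \<cdot> q2\<close>.\<close>

lemma triple:
  assumes kd: "kernel_pair \<C> d Dd d1 d2" and kc: "kernel_pair \<C> c Dc c1 c2"
    and pb: "pullback \<C> d2 c1 T q1 q2"
    and D: "Dom \<C> d = D" "Dom \<C> c = D"
    and xyz: "x \<in> Hom \<C> X D" "y \<in> Hom \<C> X D" "z \<in> Hom \<C> X D" "d \<cdot> x = d \<cdot> y" "c \<cdot> y = c \<cdot> z"
  defines "t \<equiv> pair \<C> q1 q2 (pair \<C> d1 d2 x y) (pair \<C> c1 c2 y z)"
  shows "t \<in> Hom \<C> X T" "d1 \<cdot> (q1 \<cdot> t) = x" "d2 \<cdot> (q1 \<cdot> t) = y" "c2 \<cdot> (q2 \<cdot> t) = z"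
proof -
  note [simp] = D pullbackD(4-9)[OF kd] pullbackD(4-9)[OF kc] pullbackD(4-9)[OF pb]
  have xy: "pair \<C> d1 d2 x y \<in> Hom \<C> X Dd"
    "d1 \<cdot> pair \<C> d1 d2 x y = x" "d2 \<cdot> pair \<C> d1 d2 x y = y"
    using pair[OF kd, of x X y] xyz by auto
  have yz: "pair \<C> c1 c2 y z \<in> Hom \<C> X Dc"
    "c1 \<cdot> pair \<C> c1 c2 y z = y" "c2 \<cdot> pair \<C> c1 c2 y z = z"
    using pair[OF kc, of y X z] xyz by auto
  have t: "t \<in> Hom \<C> X T" "q1 \<cdot> t = pair \<C> d1 d2 x y" "q2 \<cdot> t = pair \<C> c1 c2 y z"
    using pair[OF pb, of "pair \<C> d1 d2 x y" X "pair \<C> c1 c2 y z"] xy yz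
    unfolding t_def by auto
  with xy yz show "t \<in> Hom \<C> X T" "d1 \<cdot> (q1 \<cdot> t) = x" "d2 \<cdot> (q1 \<cdot> t) = y" "c2 \<cdot> (q2 \<cdot> t) = z"
    by simp_all
qed

text \<open>Reading difunctionality on generalized elements removes the chosen classifying objects.\<close>

lemma difunctional_elements:
  assumes "difunctional \<C> D d c"
    and xyz: "x \<in> Hom \<C> X D" "y \<in> Hom \<C> X D" "z \<in> Hom \<C> X D" "d \<cdot> x = d \<cdot> y" "c \<cdot> y = c \<cdot> z"
  shows "\<exists>t. t \<in> Hom \<C> X D \<and> d \<cdot> t = d \<cdot> z \<and> c \<cdot> t = c \<cdot> x"
proof -
  obtain Dd d1 d2 Dc c1 c2 T q1 q2 p where
    kd: "kernel_pair \<C> d Dd d1 d2" and kc: "kernel_pair \<C> c Dc c1 c2"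
    and pb: "pullback \<C> d2 c1 T q1 q2" and p: "p \<in> Hom \<C> T D"
    and eq: "\<And>X x y z. x \<in> Hom \<C> X D \<Longrightarrow> y \<in> Hom \<C> X D \<Longrightarrow> z \<in> Hom \<C> X D \<Longrightarrow>
      d \<cdot> x = d \<cdot> y \<Longrightarrow> c \<cdot> y = c \<cdot> z \<Longrightarrow>
      d \<cdot> (p \<cdot> pair \<C> q1 q2 (pair \<C> d1 d2 x y) (pair \<C> c1 c2 y z)) = d \<cdot> z \<and>
      c \<cdot> (p \<cdot> pair \<C> q1 q2 (pair \<C> d1 d2 x y) (pair \<C> c1 c2 y z)) = c \<cdot> x"
    using assms(1) unfolding difunctional_def Let_def by blast
  have D: "Dom \<C> d = D" "Dom \<C> c = D" using assms(1) by (auto simp: difunctional_def span_def)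
  show ?thesis
    using eq[OF xyz] Comp_Hom[OF triple(1)[OF kd kc pb D xyz] p] by blast
qed

lemma kernel_pairs_pullback:
  assumes "span \<C> D d c"
  obtains Dd d1 d2 Dc c1 c2 T q1 q2 where "kernel_pair \<C> d Dd d1 d2" "kernel_pair \<C> c Dc c1 c2"
    "pullback \<C> d2 c1 T q1 q2"
proof -
  obtain Dd d1 d2 Dc c1 c2 where k: "kernel_pair \<C> d Dd d1 d2" "kernel_pair \<C> c Dc c1 c2"
    using assms unfolding span_def by blast
  have "Cod \<C> d2 = Cod \<C> c1"
    using pullbackD[OF k(1)] pullbackD[OF k(2)] assms by (auto simp: span_def)
  then obtain T q1 q2 where "pullback \<C> d2 c1 T q1 q2"
    using split_pullback[of d2 c1] kernel_pair_projections_split_epi[OF k(1)]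
      kernel_pair_projections_split_epi[OF k(2)] by blast
  with k show ?thesis by (rule that)
qed

section \<open>The implications\<close>

text \<open>Inserting identities into the difunctionality operation yields composition and inversion.\<close>

theorem difunctional_imp_equivalence_relation:
  assumes R: "reflexive_strong_relation \<C> C1 C0 d e c" and dif: "difunctional \<C> C1 d c"
  shows "is_equivalence_relation \<C> C1 C0 d e c"
proof -
  have rg: "reflexive_graph \<C> C1 C0 d e c" and mono: "jointly_monic \<C> d c"
    using R dif by (auto simp: reflexive_strong_relation_def difunctional_def)
  note [simp] = reflexive_graphD[OF rg]
  obtain C2 p1 p2 where pb: "pullback \<C> d c C2 p1 p2"
    using split_pullback[of d c] reflexive_graph_split_epi[OF rg] by auto
  note [simp] = pullbackD(4-9)[OF pb] pullbackD(10)[OF pb]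
  \<comment> \<open>The middle entry is the identity at the object where the two arrows meet.\<close>
  obtain m where m: "m \<in> Hom \<C> C2 C1" "d \<cdot> m = d \<cdot> p2" "c \<cdot> m = c \<cdot> p1"
    using difunctional_elements[OF dif, of p1 C2 "e \<cdot> d \<cdot> p1" p2] by auto
  \<comment> \<open>The outer entries are the identities at the source and at the target.\<close>
  obtain i where i: "i \<in> Hom \<C> C1 C1" "d \<cdot> i = c" "c \<cdot> i = d"
    using difunctional_elements[OF dif, of "e \<cdot> d" C1 "\<one> C1" "e \<cdot> c"] by auto
  show ?thesis
    using R internal_groupoid_if_jointly_monic[OF rg mono pb m i]
    unfolding is_equivalence_relation_def by blast
qed

lemma equivalence_relation_imp_preorder:
  "is_equivalence_relation \<C> C1 C0 d e c \<Longrightarrow> is_preorder \<C> C1 C0 d e c"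
  unfolding is_equivalence_relation_def is_preorder_def internal_groupoid_def by blast

text \<open>The split epimorphisms of the dikite are the projections of the two kernel pairs onto the
  middle component of a triple, split by the diagonals; \<open>\<alpha>\<close> and \<open>\<gamma>\<close> are the outer components, so
  the lift out of the object of triples has precisely the source and target asked of \<open>p\<close>.\<close>

theorem dikites_admissible_imp_difunctional:
  assumes adm: "\<And>A B C f r g s \<alpha> \<beta> \<gamma>. dikite \<C> D d c A B C f r g s \<alpha> \<beta> \<gamma> \<Longrightarrow>
      admissible \<C> D d c A B C f r g s \<alpha> \<beta> \<gamma>"
    and R: "strong_relation \<C> D d c"
  shows "difunctional \<C> D d c"
proof -
  have sp: "span \<C> D d c" and mono: "jointly_monic \<C> d c"
    using R by (auto simp: strong_relation_def jointly_strongly_monic_def)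
  have D [simp]: "Dom \<C> d = D" "Dom \<C> c = D" "d \<in> Arr \<C>" "c \<in> Arr \<C>" "D \<in> Obj \<C>"
    using sp by (auto simp: span_def)
  obtain Dd d1 d2 Dc c1 c2 where kd: "kernel_pair \<C> d Dd d1 d2" and kc: "kernel_pair \<C> c Dc c1 c2"
    using sp unfolding span_def by blast
  note [simp] = pullbackD(4-9)[OF kd] pullbackD(4-9)[OF kc]
  let ?r = "pair \<C> d1 d2 (\<one> D) (\<one> D)" and ?s = "pair \<C> c1 c2 (\<one> D) (\<one> D)"
  have r: "?r \<in> Hom \<C> D Dd" "d1 \<cdot> ?r = \<one> D" "d2 \<cdot> ?r = \<one> D"
    using pair[OF kd, of "\<one> D" D "\<one> D"] by simp_all
  have s: "?s \<in> Hom \<C> D Dc" "c1 \<cdot> ?s = \<one> D" "c2 \<cdot> ?s = \<one> D"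
    using pair[OF kc, of "\<one> D" D "\<one> D"] by simp_all
  have "dikite \<C> D d c Dd D Dc d2 ?r c1 ?s d1 (\<one> D) c2"
    using sp r s pullbackD(10)[OF kd] pullbackD(10)[OF kc] unfolding dikite_def by simp
  from adm[OF this] obtain T q1 q2 m where pb: "pullback \<C> d2 c1 T q1 q2"
    and m: "m \<in> Hom \<C> T D" "d \<cdot> m = d \<cdot> c2 \<cdot> q2" "c \<cdot> m = c \<cdot> d1 \<cdot> q1"
    unfolding admissible_def by blast
  note [simp] = pullbackD(4-9)[OF pb]
  have "let t = pair \<C> q1 q2 (pair \<C> d1 d2 x y) (pair \<C> c1 c2 y z)
      in d \<cdot> (m \<cdot> t) = d \<cdot> z \<and> c \<cdot> (m \<cdot> t) = c \<cdot> x"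
    if xyz: "x \<in> Hom \<C> X D" "y \<in> Hom \<C> X D" "z \<in> Hom \<C> X D" "d \<cdot> x = d \<cdot> y" "c \<cdot> y = c \<cdot> z"
    for X x y z
    using triple[OF kd kc pb D(1,2) xyz] m(1) precomp1[OF m(2)] precomp1[OF m(3)]
    by (simp add: Let_def)
  then show ?thesis
    using sp mono kd kc pb m(1) unfolding difunctional_def by blast
qed

text \<open>The pullback of the two split epimorphisms of a dikite is itself a strong relation, with the
  two injections as the sections required for compatibility.\<close>

theorem compatible_imp_dikite_admissible:
  assumes comp: "\<And>E p1 p2. strong_relation \<C> E p1 p2 \<Longrightarrow> compatible \<C> E p1 p2 D d c"
    and dk: "dikite \<C> D d c A B C f r g s \<alpha> \<beta> \<gamma>"
  shows "admissible \<C> D d c A B C f r g s \<alpha> \<beta> \<gamma>"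
proof -
  have f: "f \<in> Hom \<C> A B" "r \<in> Hom \<C> B A" "f \<cdot> r = \<one> B"
    and g: "g \<in> Hom \<C> C B" "s \<in> Hom \<C> B C" "g \<cdot> s = \<one> B"
    and \<alpha>: "\<alpha> \<in> Hom \<C> A D" "\<alpha> \<cdot> r = \<beta>" "d \<cdot> \<alpha> = d \<cdot> \<beta> \<cdot> f"
    and \<beta>: "\<beta> \<in> Hom \<C> B D"
    and \<gamma>: "\<gamma> \<in> Hom \<C> C D" "\<gamma> \<cdot> s = \<beta>" "c \<cdot> \<gamma> = c \<cdot> \<beta> \<cdot> g"
    and sp: "span \<C> D d c"
    using dk unfolding dikite_def by auto
  have [simp]: "Dom \<C> d = D" "Dom \<C> c = D" "d \<in> Arr \<C>" "c \<in> Arr \<C>"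
    using sp by (auto simp: span_def)
  have [simp]: "A \<in> Obj \<C>" "B \<in> Obj \<C>" "C \<in> Obj \<C>" using f g by auto
  note [simp] = f[unfolded Hom_iff] g[unfolded Hom_iff] \<alpha>(1)[unfolded Hom_iff] \<beta>[unfolded Hom_iff]
    \<gamma>(1)[unfolded Hom_iff]
  have se: "split_epi \<C> f" "split_epi \<C> g"
    using f g split_epiI by blast+
  then obtain P \<pi>1 \<pi>2 where pb: "pullback \<C> f g P \<pi>1 \<pi>2"
    using split_pullback[of f g] by auto
  have \<pi> [simp]: "\<pi>1 \<in> Arr \<C>" "Dom \<C> \<pi>1 = P" "Cod \<C> \<pi>1 = A"
    "\<pi>2 \<in> Arr \<C>" "Dom \<C> \<pi>2 = P" "Cod \<C> \<pi>2 = C" "f \<cdot> \<pi>1 = g \<cdot> \<pi>2"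
    using pullbackD[OF pb] by auto
  have "strong_relation \<C> P \<pi>1 \<pi>2"
    unfolding strong_relation_def
    using split_span pullback_projections_split_epi[OF pb se] pullback_jointly_strongly_monic[OF pb]
    by simp
  note cm = comp[OF this, unfolded compatible_def]
  define E1 where "E1 = pair \<C> \<pi>1 \<pi>2 (\<one> A) (s \<cdot> f)"
  define E2 where "E2 = pair \<C> \<pi>1 \<pi>2 (r \<cdot> g) (\<one> C)"
  note inj = local_product_injections[OF pb f g, folded E1_def E2_def]
  note [simp] = inj[unfolded Hom_iff]
  note [simp] = precomp1[OF f(3)] precomp1[OF g(3)] precomp1[OF \<alpha>(2)] precomp1[OF \<gamma>(2)]
    precomp1[OF \<alpha>(3)] precomp1[OF \<gamma>(3)] precomp[OF \<pi>(7)]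
    precomp1[OF inj(2)] precomp1[OF inj(3)] precomp1[OF inj(5)] precomp1[OF inj(6)]
  have "(E1 \<cdot> \<pi>1) \<cdot> (E2 \<cdot> \<pi>2) = (E2 \<cdot> \<pi>2) \<cdot> (E1 \<cdot> \<pi>1)"
    by (rule jointly_monicD[OF pullback_jointly_monic[OF pb], of _ P]) auto
  moreover have "\<alpha> \<cdot> \<pi>1 \<cdot> (E2 \<cdot> \<pi>2) = \<gamma> \<cdot> \<pi>2 \<cdot> (E1 \<cdot> \<pi>1)" by simp
  moreover have "d \<cdot> \<alpha> \<cdot> \<pi>1 = d \<cdot> \<alpha> \<cdot> \<pi>1 \<cdot> (E2 \<cdot> \<pi>2)" by simp
  moreover have "c \<cdot> \<gamma> \<cdot> \<pi>2 = c \<cdot> \<gamma> \<cdot> \<pi>2 \<cdot> (E1 \<cdot> \<pi>1)" by simp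
  ultimately have "\<exists>!m. m \<in> Hom \<C> P D \<and> m \<cdot> E1 = \<alpha> \<and> m \<cdot> E2 = \<gamma> \<and>
      d \<cdot> m = d \<cdot> \<gamma> \<cdot> \<pi>2 \<and> c \<cdot> m = c \<cdot> \<alpha> \<cdot> \<pi>1"
    using cm inj(1,2,4,6) \<alpha>(1) \<gamma>(1) unfolding \<pi>(3,6) by blast
  with dk pb show ?thesis
    unfolding admissible_def E1_def E2_def by blast
qed


text \<open>Let \<open>B\<close> split the idempotent \<open>e1 \<cdot> p1 \<cdot> e2 \<cdot> p2\<close>. Then \<open>A\<close> and \<open>C\<close> retract onto \<open>B\<close>, and \<open>E\<close> compares
  to their pullback \<open>P\<close> over \<open>B\<close> in such a way that \<open>e1\<close> and \<open>e2\<close> become the injections of \<open>P\<close>.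
  These are jointly epic, so the strength of \<open>E\<close> gives a map from \<open>P\<close> back to \<open>E\<close>, of which the
  comparison is a section; hence \<open>e1\<close> and \<open>e2\<close> are jointly epic too.\<close>

lemma sections_of_strong_relation_jointly_epic:
  assumes wM: "weakly_Maltsev \<C>" and eq: "has_equalizers \<C>"
    and jsm: "jointly_strongly_monic \<C> p1 p2"
    and p: "p1 \<in> Hom \<C> E A" "p2 \<in> Hom \<C> E C"
    and e: "e1 \<in> Hom \<C> A E" "e2 \<in> Hom \<C> C E" "p1 \<cdot> e1 = \<one> A" "p2 \<cdot> e2 = \<one> C"
    and comm: "(e1 \<cdot> p1) \<cdot> (e2 \<cdot> p2) = (e2 \<cdot> p2) \<cdot> (e1 \<cdot> p1)"
  shows "jointly_epic \<C> e1 e2"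
proof -
  note mono = jointly_strongly_monic_imp_jointly_monic[OF jsm]
  note [simp] = p[unfolded Hom_iff] e(1,2)[unfolded Hom_iff] e(3,4) precomp1[OF e(3)] precomp1[OF e(4)]
  have [simp]: "A \<in> Obj \<C>" "C \<in> Obj \<C>" "E \<in> Obj \<C>" using Hom_Obj[OF p(1)] Hom_Obj[OF p(2)] by auto
  have comm': "e1 \<cdot> (p1 \<cdot> (e2 \<cdot> p2)) = e2 \<cdot> (p2 \<cdot> (e1 \<cdot> p1))" using comm by simp
  have comm'': "e1 \<cdot> (p1 \<cdot> (e2 \<cdot> (p2 \<cdot> x))) = e2 \<cdot> (p2 \<cdot> (e1 \<cdot> (p1 \<cdot> x)))"
    if "x \<in> Arr \<C>" "Cod \<C> x = E" for x
    using precomp[of "e1 \<cdot> p1" "e2 \<cdot> p2" "e2 \<cdot> p2" "e1 \<cdot> p1" x] comm that by simp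
  define \<epsilon> where "\<epsilon> = e1 \<cdot> (p1 \<cdot> (e2 \<cdot> p2))"
  have \<epsilon> [simp]: "\<epsilon> \<in> Arr \<C>" "Dom \<C> \<epsilon> = E" "Cod \<C> \<epsilon> = E" by (auto simp: \<epsilon>_def)
  have "\<epsilon> \<cdot> \<epsilon> = \<epsilon>" by (simp add: \<epsilon>_def comm'' comm')
  then obtain B k q where k: "k \<in> Hom \<C> B E" and q: "q \<in> Hom \<C> E B"
    and kq: "k \<cdot> q = \<epsilon>" and qk: "q \<cdot> k = \<one> B"
    using idempotent_splits[OF eq, of \<epsilon> E] by auto
  note [simp] = k[unfolded Hom_iff] q[unfolded Hom_iff] qk precomp1[OF kq] precomp1[OF qk]
  have [simp]: "B \<in> Obj \<C>" using Hom_Obj[OF k] by auto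
  have \<epsilon>k: "\<epsilon> \<cdot> k = k" using precomp1[OF kq, of k] by simp
  have q\<epsilon>: "q \<cdot> \<epsilon> = q" using precomp1[OF qk, of q] kq by simp
  have k1 [simp]: "e1 \<cdot> (p1 \<cdot> k) = k"
  proof -
    have "e1 \<cdot> (p1 \<cdot> (\<epsilon> \<cdot> k)) = \<epsilon> \<cdot> k" by (simp add: \<epsilon>_def)
    then show ?thesis by (simp only: \<epsilon>k)
  qed
  have k2 [simp]: "e2 \<cdot> (p2 \<cdot> k) = k"
  proof -
    have "e2 \<cdot> (p2 \<cdot> (\<epsilon> \<cdot> k)) = \<epsilon> \<cdot> k" by (simp add: \<epsilon>_def comm'' comm')
    then show ?thesis by (simp only: \<epsilon>k)
  qed
  have q1 [simp]: "q \<cdot> (e1 \<cdot> p1) = q"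
  proof -
    have "\<epsilon> \<cdot> (e1 \<cdot> p1) = \<epsilon>" by (simp add: \<epsilon>_def comm'' comm')
    then show ?thesis using precomp1[OF q\<epsilon>, of "e1 \<cdot> p1"] q\<epsilon> by simp
  qed
  have q2 [simp]: "q \<cdot> (e2 \<cdot> p2) = q"
  proof -
    have "\<epsilon> \<cdot> (e2 \<cdot> p2) = \<epsilon>" by (simp add: \<epsilon>_def)
    then show ?thesis using precomp1[OF q\<epsilon>, of "e2 \<cdot> p2"] q\<epsilon> by simp
  qed
  have f: "q \<cdot> e1 \<in> Hom \<C> A B" "p1 \<cdot> k \<in> Hom \<C> B A" "(q \<cdot> e1) \<cdot> (p1 \<cdot> k) = \<one> B"
    and g: "q \<cdot> e2 \<in> Hom \<C> C B" "p2 \<cdot> k \<in> Hom \<C> B C" "(q \<cdot> e2) \<cdot> (p2 \<cdot> k) = \<one> B"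
    by simp_all
  obtain P \<pi>1 \<pi>2 where pb: "pullback \<C> (q \<cdot> e1) (q \<cdot> e2) P \<pi>1 \<pi>2"
    using split_pullback[OF split_epiI[OF f] split_epiI[OF g]] by auto
  have [simp]: "\<pi>1 \<in> Arr \<C>" "Dom \<C> \<pi>1 = P" "Cod \<C> \<pi>1 = A"
    "\<pi>2 \<in> Arr \<C>" "Dom \<C> \<pi>2 = P" "Cod \<C> \<pi>2 = C"
    using pullbackD[OF pb] by auto
  define E1 where "E1 = pair \<C> \<pi>1 \<pi>2 (\<one> A) ((p2 \<cdot> k) \<cdot> (q \<cdot> e1))"
  define E2 where "E2 = pair \<C> \<pi>1 \<pi>2 ((p1 \<cdot> k) \<cdot> (q \<cdot> e2)) (\<one> C)"
  note inj = local_product_injections[OF pb f g, folded E1_def E2_def]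
  have "local_product \<C> P A C \<pi>1 E1 \<pi>2 E2"
    unfolding local_product_def E1_def E2_def using f g pb by blast
  then have epi: "jointly_epic \<C> E1 E2" using wM unfolding weakly_Maltsev_def by blast
  have sf: "(p2 \<cdot> k) \<cdot> (q \<cdot> e1) = p2 \<cdot> e1" by (simp add: \<epsilon>_def comm')
  have rg: "(p1 \<cdot> k) \<cdot> (q \<cdot> e2) = p1 \<cdot> e2" by (simp add: \<epsilon>_def)
  obtain m where m: "m \<in> Hom \<C> P E" "m \<cdot> E1 = e1" "m \<cdot> E2 = e2" "p1 \<cdot> m = \<pi>1" "p2 \<cdot> m = \<pi>2"
    using ex1_implies_ex[OF jointly_strongly_monicD[OF jsm epi inj(1,4), of e1 e2 \<pi>1 \<pi>2]]
      inj sf rg by auto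
  define t where "t = pair \<C> \<pi>1 \<pi>2 p1 p2"
  have t: "t \<in> Hom \<C> E P" "\<pi>1 \<cdot> t = p1" "\<pi>2 \<cdot> t = p2"
    using pair[OF pb, of p1 E p2] by (auto simp: t_def)
  have mt: "m \<cdot> t = \<one> E"
    by (rule jointly_monicD[OF mono, of _ E])
      (use m(1) t in \<open>auto simp: precomp1[OF m(4)] precomp1[OF m(5)]\<close>)
  have "h = h'" if h: "h \<in> Hom \<C> E Z" "h' \<in> Hom \<C> E Z" "h \<cdot> e1 = h' \<cdot> e1" "h \<cdot> e2 = h' \<cdot> e2" for Z h h'
  proof -
    have "h \<cdot> m = h' \<cdot> m"
      by (rule jointly_epicD[OF epi, of _ Z]) (use h m inj(1,4) in auto)
    then have "h \<cdot> m \<cdot> t = h' \<cdot> m \<cdot> t" by simp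
    then show ?thesis using h(1,2) m(1) t(1) mt by simp
  qed
  then show ?thesis unfolding jointly_epic_def by simp
qed

text \<open>The equations in the definition of compatibility are what makes \<open>(\<alpha>, \<gamma>)\<close> and
  \<open>(d \<cdot> \<gamma> \<cdot> p2, c \<cdot> \<alpha> \<cdot> p1)\<close> a lifting problem against \<open>(e1, e2)\<close>.\<close>

theorem weakly_Maltsev_imp_compatible:
  assumes wM: "weakly_Maltsev \<C>" and eq: "has_equalizers \<C>"
    and E: "strong_relation \<C> E p1 p2" and D: "strong_relation \<C> D d c"
  shows "compatible \<C> E p1 p2 D d c"
  unfolding compatible_def
proof (intro conjI allI impI; (elim conjE)?)
  show spE: "span \<C> E p1 p2" and spD: "span \<C> D d c"
    using E D by (auto simp: strong_relation_def)
  have jsm: "jointly_strongly_monic \<C> d c" using D by (simp add: strong_relation_def)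
  fix \<alpha> \<gamma> e1 e2
  let ?A = "Cod \<C> p1" and ?C = "Cod \<C> p2"
  assume \<alpha>: "\<alpha> \<in> Hom \<C> ?A D" and \<gamma>: "\<gamma> \<in> Hom \<C> ?C D"
    and e: "e1 \<in> Hom \<C> ?A E" "e2 \<in> Hom \<C> ?C E" "p1 \<cdot> e1 = \<one> ?A" "p2 \<cdot> e2 = \<one> ?C"
    and comm: "(e1 \<cdot> p1) \<cdot> (e2 \<cdot> p2) = (e2 \<cdot> p2) \<cdot> (e1 \<cdot> p1)"
    and eqs: "\<alpha> \<cdot> p1 \<cdot> (e2 \<cdot> p2) = \<gamma> \<cdot> p2 \<cdot> (e1 \<cdot> p1)"
      "d \<cdot> \<alpha> \<cdot> p1 = d \<cdot> \<alpha> \<cdot> p1 \<cdot> (e2 \<cdot> p2)" "c \<cdot> \<gamma> \<cdot> p2 = c \<cdot> \<gamma> \<cdot> p2 \<cdot> (e1 \<cdot> p1)"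
  have [simp]: "Dom \<C> d = D" "Dom \<C> c = D" "d \<in> Arr \<C>" "c \<in> Arr \<C>"
    "p1 \<in> Arr \<C>" "Dom \<C> p1 = E" "p2 \<in> Arr \<C>" "Dom \<C> p2 = E"
    using spE spD by (auto simp: span_def)
  note [simp] = \<alpha>[unfolded Hom_iff] \<gamma>[unfolded Hom_iff] e(1,2)[unfolded Hom_iff] e(3,4)
    precomp1[OF e(3)] precomp1[OF e(4)]
  have epi: "jointly_epic \<C> e1 e2"
    by (rule sections_of_strong_relation_jointly_epic[OF wM eq _ _ _ e comm])
      (use E in \<open>auto simp: strong_relation_def\<close>)
  have "d \<cdot> \<gamma> \<cdot> p2 \<cdot> e1 = d \<cdot> ((\<gamma> \<cdot> p2 \<cdot> (e1 \<cdot> p1)) \<cdot> e1)" by simp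
  also have "\<dots> = d \<cdot> ((\<alpha> \<cdot> p1 \<cdot> (e2 \<cdot> p2)) \<cdot> e1)" by (simp only: eqs(1))
  also have "\<dots> = (d \<cdot> \<alpha> \<cdot> p1 \<cdot> (e2 \<cdot> p2)) \<cdot> e1" by simp
  also have "\<dots> = (d \<cdot> \<alpha> \<cdot> p1) \<cdot> e1" by (simp only: eqs(2)[symmetric])
  also have "\<dots> = d \<cdot> \<alpha>" by simp
  finally have 1: "d \<cdot> \<gamma> \<cdot> p2 \<cdot> e1 = d \<cdot> \<alpha>" .
  have "c \<cdot> \<alpha> \<cdot> p1 \<cdot> e2 = c \<cdot> ((\<alpha> \<cdot> p1 \<cdot> (e2 \<cdot> p2)) \<cdot> e2)" by simp
  also have "\<dots> = c \<cdot> ((\<gamma> \<cdot> p2 \<cdot> (e1 \<cdot> p1)) \<cdot> e2)" by (simp only: eqs(1))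
  also have "\<dots> = (c \<cdot> \<gamma> \<cdot> p2 \<cdot> (e1 \<cdot> p1)) \<cdot> e2" by simp
  also have "\<dots> = (c \<cdot> \<gamma> \<cdot> p2) \<cdot> e2" by (simp only: eqs(3)[symmetric])
  also have "\<dots> = c \<cdot> \<gamma>" by simp
  finally have 2: "c \<cdot> \<alpha> \<cdot> p1 \<cdot> e2 = c \<cdot> \<gamma>" .
  show "\<exists>!m. m \<in> Hom \<C> E D \<and> m \<cdot> e1 = \<alpha> \<and> m \<cdot> e2 = \<gamma> \<and> d \<cdot> m = d \<cdot> \<gamma> \<cdot> p2 \<and> c \<cdot> m = c \<cdot> \<alpha> \<cdot> p1"
    using jointly_strongly_monicD[OF jsm epi e(1,2), of \<alpha> \<gamma> "d \<cdot> \<gamma> \<cdot> p2" "c \<cdot> \<alpha> \<cdot> p1"] 1 2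
    by simp
qed

text \<open>On the object \<open>D\<close>, relate \<open>x\<close> to \<open>z\<close> when some \<open>y\<close> has the source of \<open>x\<close> and the target of
  \<open>z\<close>. This relation is represented by the object of triples, is reflexive through the constant
  triples, and inherits strength from \<open>(d, c)\<close>, which lifts the middle component. In the claim,
  \<open>x\<close> is related to \<open>y\<close> with \<open>x\<close> itself in the middle, and \<open>y\<close> to \<open>z\<close> with \<open>z\<close> in the middle;
  the middle of the composite is the element sought. The legs \<open>d\<close> and \<open>c\<close> are split so that their
  kernel pairs exist.\<close>

lemma preorders_imp_difunctional_elements:
  assumes pre: "\<And>C1 C0 d e c. reflexive_strong_relation \<C> C1 C0 d e c \<Longrightarrow> is_preorder \<C> C1 C0 d e c"
    and jsm: "jointly_strongly_monic \<C> d c" and se: "split_epi \<C> d" "split_epi \<C> c"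
    and D: "Dom \<C> d = D"
    and xyz: "x \<in> Hom \<C> X D" "y \<in> Hom \<C> X D" "z \<in> Hom \<C> X D" "c \<cdot> x = c \<cdot> y" "d \<cdot> y = d \<cdot> z"
  shows "\<exists>t. t \<in> Hom \<C> X D \<and> d \<cdot> t = d \<cdot> x \<and> c \<cdot> t = c \<cdot> z"
proof -
  note mono = jointly_strongly_monic_imp_jointly_monic[OF jsm]
  have Dd [simp]: "Dom \<C> d = D" "Dom \<C> c = D" "d \<in> Arr \<C>" "c \<in> Arr \<C>" "D \<in> Obj \<C>"
    using mono D by (auto simp: jointly_monic_def)
  obtain Dd d1 d2 Dc c1 c2 T q1 q2 where kd: "kernel_pair \<C> d Dd d1 d2"
    and kc: "kernel_pair \<C> c Dc c1 c2" and pb: "pullback \<C> d2 c1 T q1 q2"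
    using kernel_pairs_pullback[OF split_span[OF se Dd(1,2)]] by metis
  note [simp] = pullbackD(4-9)[OF kd] pullbackD(4-9)[OF kc] pullbackD(4-9)[OF pb]
  note [simp] = pullbackD(10)[OF pb, symmetric] precomp[OF pullbackD(10)[OF pb, symmetric]]
  note tr = triple[OF kd kc pb Dd(1,2)]
  define t1 where "t1 = d1 \<cdot> q1"
  define t2 where "t2 = d2 \<cdot> q1"
  define t3 where "t3 = c2 \<cdot> q2"
  have t [simp]: "t1 \<in> Arr \<C>" "Dom \<C> t1 = T" "Cod \<C> t1 = D" "t2 \<in> Arr \<C>" "Dom \<C> t2 = T" "Cod \<C> t2 = D"
    "t3 \<in> Arr \<C>" "Dom \<C> t3 = T" "Cod \<C> t3 = D"
    by (auto simp: t1_def t2_def t3_def)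
  have dt: "d \<cdot> t1 = d \<cdot> t2"
    using precomp[OF pullbackD(10)[OF kd], of q1] by (simp add: t1_def t2_def)
  have ct: "c \<cdot> t2 = c \<cdot> t3"
    using precomp[OF pullbackD(10)[OF kc], of q2] by (simp add: t2_def t3_def)
  note dt' = precomp[OF dt] and ct' = precomp[OF ct]
  have triple: "\<exists>t. t \<in> Hom \<C> X T \<and> t1 \<cdot> t = x \<and> t2 \<cdot> t = y \<and> t3 \<cdot> t = z"
    if "x \<in> Hom \<C> X D" "y \<in> Hom \<C> X D" "z \<in> Hom \<C> X D" "d \<cdot> x = d \<cdot> y" "c \<cdot> y = c \<cdot> z" for X x y z
    using tr[OF that] unfolding t1_def t2_def t3_def
    by (intro exI[of _ "pair \<C> q1 q2 (pair \<C> d1 d2 x y) (pair \<C> c1 c2 y z)"]) simp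
  have mono13: "jointly_monic \<C> t1 t3"
  proof (rule jointly_monicI)
    show "t1 \<in> Hom \<C> T D" "t3 \<in> Hom \<C> T D" by auto
    fix X h k
    assume h: "h \<in> Hom \<C> X T" "k \<in> Hom \<C> X T" and e1: "t1 \<cdot> h = t1 \<cdot> k" and e3: "t3 \<cdot> h = t3 \<cdot> k"
    have e2: "t2 \<cdot> h = t2 \<cdot> k"
      by (rule jointly_monicD[OF mono, of _ X])
        (use h e1 e3 dt'[of h] dt'[of k] ct'[of h] ct'[of k] in auto)
    have "q1 \<cdot> h = q1 \<cdot> k"
      by (rule jointly_monicD[OF pullback_jointly_monic[OF kd], of _ X])
        (use h e1 e2 in \<open>auto simp: t1_def t2_def\<close>)
    moreover have "q2 \<cdot> h = q2 \<cdot> k"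
      by (rule jointly_monicD[OF pullback_jointly_monic[OF kc], of _ X])
        (use h e3 e2 in \<open>auto simp: t2_def t3_def\<close>)
    ultimately show "h = k"
      by (intro jointly_monicD[OF pullback_jointly_monic[OF pb], of h X k]) (use h in auto)
  qed
  have jsm13: "jointly_strongly_monic \<C> t1 t3"
  proof (rule jointly_strongly_monicI[OF mono13])
    fix A C E e1 e2 \<alpha> \<gamma> u v
    assume e: "e1 \<in> Hom \<C> A E" "e2 \<in> Hom \<C> C E" "jointly_epic \<C> e1 e2"
      and \<alpha>: "\<alpha> \<in> Hom \<C> A (Dom \<C> t1)" and \<gamma>: "\<gamma> \<in> Hom \<C> C (Dom \<C> t1)"
      and uv: "u \<in> Hom \<C> E (Cod \<C> t1)" "v \<in> Hom \<C> E (Cod \<C> t3)"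
      and eqs: "u \<cdot> e1 = t1 \<cdot> \<alpha>" "u \<cdot> e2 = t1 \<cdot> \<gamma>" "v \<cdot> e1 = t3 \<cdot> \<alpha>" "v \<cdot> e2 = t3 \<cdot> \<gamma>"
    obtain w where w: "w \<in> Hom \<C> E D" "d \<cdot> w = d \<cdot> u" "c \<cdot> w = c \<cdot> v"
      using ex1_implies_ex[OF jointly_strongly_monicD[OF jsm e(3,1,2),
          of "t2 \<cdot> \<alpha>" "t2 \<cdot> \<gamma>" "d \<cdot> u" "c \<cdot> v"]] e \<alpha> \<gamma> uv eqs
        dt'[of \<alpha>] dt'[of \<gamma>] ct'[of \<alpha>] ct'[of \<gamma>] by auto
    then show "\<exists>m. m \<in> Hom \<C> E (Dom \<C> t1) \<and> t1 \<cdot> m = u \<and> t3 \<cdot> m = v"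
      using triple[of u E w v] uv by auto
  qed
  obtain e where e: "e \<in> Hom \<C> D T" "t1 \<cdot> e = \<one> D" "t2 \<cdot> e = \<one> D" "t3 \<cdot> e = \<one> D"
    using triple[of "\<one> D" D "\<one> D" "\<one> D"] by auto
  have rg: "reflexive_graph \<C> T D t1 e t3"
    unfolding reflexive_graph_def using e by simp
  have "reflexive_strong_relation \<C> T D t1 e t3"
    unfolding reflexive_strong_relation_def strong_relation_def
    using rg split_span[OF reflexive_graph_split_epi[OF rg]] jsm13 by simp
  then obtain T2 r1 r2 m where "internal_category \<C> T D t1 e t3 T2 r1 r2 m"
    using pre unfolding is_preorder_def by blast
  then have pb2: "pullback \<C> t1 t3 T2 r1 r2"
    and m: "m \<in> Hom \<C> T2 T" "t1 \<cdot> m = t1 \<cdot> r2" "t3 \<cdot> m = t3 \<cdot> r1"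
    unfolding internal_category_def by auto
  note [simp] = pullbackD(4-9)[OF pb2]
  obtain a where a: "a \<in> Hom \<C> X T" "t1 \<cdot> a = x" "t3 \<cdot> a = y"
    using triple[of x X x y] xyz by auto
  obtain b where b: "b \<in> Hom \<C> X T" "t1 \<cdot> b = y" "t3 \<cdot> b = z"
    using triple[of y X z z] xyz by auto
  \<comment> \<open>Composition takes the later arrow as its first argument.\<close>
  define w where "w = pair \<C> r1 r2 b a"
  have w: "w \<in> Hom \<C> X T2" "r1 \<cdot> w = b" "r2 \<cdot> w = a"
    using pair[OF pb2, of b X a] a b unfolding w_def by auto
  have "t1 \<cdot> (m \<cdot> w) = x" "t3 \<cdot> (m \<cdot> w) = z"
    using m(1) w(1) by (simp_all add: precomp[OF m(2)] precomp[OF m(3)] w(2,3) a(2) b(3))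
  then have "d \<cdot> (t2 \<cdot> (m \<cdot> w)) = d \<cdot> x" "c \<cdot> (t2 \<cdot> (m \<cdot> w)) = c \<cdot> z"
    using dt'[of "m \<cdot> w"] ct'[of "m \<cdot> w"] m(1) w by auto
  then show ?thesis
    using m(1) w(1) by (intro exI[of _ "t2 \<cdot> (m \<cdot> w)"]) auto
qed

text \<open>Difunctionality of the equalizer of \<open>h\<close> and \<open>k\<close> gives a section of its inclusion into the
  local product.\<close>

theorem preorders_imp_weakly_Maltsev:
  assumes pre: "\<And>C1 C0 d e c. reflexive_strong_relation \<C> C1 C0 d e c \<Longrightarrow> is_preorder \<C> C1 C0 d e c"
    and eqs: "has_equalizers \<C>"
  shows "weakly_Maltsev \<C>"
  unfolding weakly_Maltsev_def
proof (intro conjI pullbacks allI impI)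
  fix E A C p1 e1 p2 e2
  assume "local_product \<C> E A C p1 e1 p2 e2"
  then obtain B f r g s where f: "f \<in> Hom \<C> A B" "r \<in> Hom \<C> B A" "f \<cdot> r = \<one> B"
    and g: "g \<in> Hom \<C> C B" "s \<in> Hom \<C> B C" "g \<cdot> s = \<one> B"
    and pb: "pullback \<C> f g E p1 p2"
    and e1_def: "e1 = pair \<C> p1 p2 (\<one> A) (s \<cdot> f)" and e2_def: "e2 = pair \<C> p1 p2 (r \<cdot> g) (\<one> C)"
    unfolding local_product_def by blast
  note inj = local_product_injections[OF pb f g, folded e1_def e2_def]
  note [simp] = f[unfolded Hom_iff] g[unfolded Hom_iff] inj[unfolded Hom_iff]
    precomp1[OF f(3)] precomp1[OF g(3)]
    precomp1[OF inj(2)] precomp1[OF inj(3)] precomp1[OF inj(5)] precomp1[OF inj(6)]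
  have p [simp]: "p1 \<in> Arr \<C>" "Dom \<C> p1 = E" "Cod \<C> p1 = A"
    "p2 \<in> Arr \<C>" "Dom \<C> p2 = E" "Cod \<C> p2 = C" "f \<cdot> p1 = g \<cdot> p2"
    using pullbackD[OF pb] by auto
  have [simp]: "A \<in> Obj \<C>" "B \<in> Obj \<C>" "C \<in> Obj \<C>" "E \<in> Obj \<C>"
    using Hom_Obj[OF f(1)] Hom_Obj[OF g(1)] Dom_Obj[OF p(1)] by simp_all
  have "h = k" if hk: "h \<in> Hom \<C> E Z" "k \<in> Hom \<C> E Z" "h \<cdot> e1 = k \<cdot> e1" "h \<cdot> e2 = k \<cdot> e2" for Z h k
  proof -
    obtain S \<iota> where eq: "equalizer \<C> h k S \<iota>"
      using eqs hk(1,2) unfolding has_equalizers_def by blast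
    have \<iota> [simp]: "\<iota> \<in> Arr \<C>" "Dom \<C> \<iota> = S" "Cod \<C> \<iota> = E" "h \<cdot> \<iota> = k \<cdot> \<iota>"
      using equalizerD[OF eq] hk by auto
    obtain i1 where i1: "i1 \<in> Hom \<C> A S" "\<iota> \<cdot> i1 = e1"
      using ex1_implies_ex[OF equalizer_factor[OF eq, of e1 A]] hk by auto
    obtain i2 where i2: "i2 \<in> Hom \<C> C S" "\<iota> \<cdot> i2 = e2"
      using ex1_implies_ex[OF equalizer_factor[OF eq, of e2 C]] hk by auto
    note [simp] = i1[unfolded Hom_iff] i2[unfolded Hom_iff] precomp1[OF i1(2)] precomp1[OF i2(2)]
    have jsm: "jointly_strongly_monic \<C> (p1 \<cdot> \<iota>) (p2 \<cdot> \<iota>)"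
      by (rule equalizer_jointly_strongly_monic[OF pullback_jointly_strongly_monic[OF pb] eq])
        (use hk in simp)
    have se: "split_epi \<C> (p1 \<cdot> \<iota>)" "split_epi \<C> (p2 \<cdot> \<iota>)"
      using split_epiI[of "p1 \<cdot> \<iota>" S A i1] split_epiI[of "p2 \<cdot> \<iota>" S C i2] by auto
    \<comment> \<open>The element \<open>(r f a, s f a)\<close> links \<open>(a, s f a)\<close> to \<open>(r g c, c)\<close>.\<close>
    have "\<exists>t. t \<in> Hom \<C> E S \<and> (p1 \<cdot> \<iota>) \<cdot> t = (p1 \<cdot> \<iota>) \<cdot> (i1 \<cdot> p1) \<and> (p2 \<cdot> \<iota>) \<cdot> t = (p2 \<cdot> \<iota>) \<cdot> (i2 \<cdot> p2)"
      by (rule preorders_imp_difunctional_elements[OF pre jsm se, of _ _ _ "i2 \<cdot> (s \<cdot> (f \<cdot> p1))"])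
        auto
    then obtain t where t: "t \<in> Hom \<C> E S" "p1 \<cdot> (\<iota> \<cdot> t) = p1" "p2 \<cdot> (\<iota> \<cdot> t) = p2"
      by auto
    have "\<iota> \<cdot> t = \<one> E"
      by (rule jointly_monicD[OF pullback_jointly_monic[OF pb], of _ E]) (use t in auto)
    then show "h = k"
      using precomp[OF \<iota>(4), of t] t(1) hk(1,2) by simp
  qed
  then show "jointly_epic \<C> e1 e2" unfolding jointly_epic_def by simp
qed

end

theorem corollary1:
  fixes \<C> :: "('o, 'm) precategory"
  assumes "category \<C>"
    and "has_pullbacks_of_split_epis \<C>"
    and "has_equalizers \<C>"
  shows "all_equivalent
    [weakly_Maltsev \<C>,
     \<forall>C1 C0 d e c. reflexive_strong_relation \<C> C1 C0 d e c \<longrightarrow>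
       is_equivalence_relation \<C> C1 C0 d e c,
     \<forall>C1 C0 d e c. reflexive_strong_relation \<C> C1 C0 d e c \<longrightarrow>
       is_preorder \<C> C1 C0 d e c,
     \<forall>E p1 p2. strong_relation \<C> E p1 p2 \<longrightarrow>
       (\<forall>D d c. strong_relation \<C> D d c \<longrightarrow> compatible \<C> E p1 p2 D d c),
     \<forall>D d c A B C f r g s \<alpha> \<beta> \<gamma>.
       dikite \<C> D d c A B C f r g s \<alpha> \<beta> \<gamma> \<and> strong_relation \<C> D d c \<longrightarrow>
       admissible \<C> D d c A B C f r g s \<alpha> \<beta> \<gamma>,
     \<forall>D d c. strong_relation \<C> D d c \<longrightarrow> difunctional \<C> D d c]"
    (is "all_equivalent [?weakly_Maltsev, ?equivalence, ?preorder, ?compatible, ?admissible, ?difunctional]")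
proof -
  interpret category_with_split_pullbacks \<C>
    using assms by (simp add: category_with_split_pullbacks_def category_with_split_pullbacks_axioms_def)
  have "?weakly_Maltsev \<Longrightarrow> ?compatible"
    using weakly_Maltsev_imp_compatible assms(3) by blast
  moreover have "?compatible \<Longrightarrow> ?admissible"
    by (intro allI impI, elim conjE, rule compatible_imp_dikite_admissible) blast+
  moreover have "?admissible \<Longrightarrow> ?difunctional"
    by (intro allI impI, rule dikites_admissible_imp_difunctional) blast+
  moreover have "?difunctional \<Longrightarrow> ?equivalence"
    using difunctional_imp_equivalence_relation unfolding reflexive_strong_relation_def by blast
  moreover have "?equivalence \<Longrightarrow> ?preorder"
    by (intro allI impI equivalence_relation_imp_preorder) blast
  moreover have "?preorder \<Longrightarrow> ?weakly_Maltsev"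
    by (rule preorders_imp_weakly_Maltsev) (use assms(3) in blast)+
  ultimately show ?thesis
    unfolding all_equivalent_def by (simp only: list.set ball_simps) argo
qed

end
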